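(* Fix integers $n\geq 1$ and $N\geq n+2$, and consider the functional $G_{n,N}:\mathrm{LC}_{\rm c}(\mathbb{R}^n)\to[0,\infty)$ defined by \[ G_{n,N}(f):=\inf_{p\in\mathscr{P}_N(f)}\{J(f)-J(p)\}. \] Then for every $f\in\mathrm{LC}_{\rm c}(\mathbb{R}^n)$, we have \[ G_{n,N}(f)\leq G_{n,N}(f^* ), \] where $f^*$ is the symmetric decreasing rearrangement of $f$.
   Context: **Function classes.** For a convex function $\psi:\mathbb{R}^n\to\mathbb{R}\cup\{+\infty\}$, its effective domain is $\mathrm{dom}(\psi)=\{x:\psi(x)<+\infty\}$ and its epigraph is $\mathrm{epi}(\psi)=\{(x,t)\in\mathbb{R}^n\times\mathbb{R}: t\geq\psi(x)\}$. $\mathrm{Conv}_{\rm c}(\mathbb{R}^n)$ is the set of convex functions $\psi:\mathbb{R}^n\to\mathbb{R}\cup\{+\infty\}$ which are coercive ($\lim_{\|x\|\to\infty}\psi(x)=\infty$), lower semicontinuous (closed epigraph), $\psi\not\equiv+\infty$, with $o\in\mathrm{dom}(\psi)$ (where $o$ is the origin) and $\mathrm{dom}(\psi)$ not contained in a hyperplane. $\mathrm{LC}_{\rm c}(\mathbb{R}^n):=\{e^{-\psi}:\psi\in\mathrm{Conv}_{\rm c}(\mathbb{R}^n)\}$, with $e^{-\infty}=0$. All such functions are integrable. The total mass of an integrable $f:\mathbb{R}^n\to[0,\infty)$ is $J(f)=\int_{\mathbb{R}^n}f(x)\,dx$. **Inner linearizations.** Given convex $\psi$ and a finite nonempty set $\mathbf{X}=\{(x_1,y_1),\ldots,(x_M,y_M)\}\subset\mathrm{epi}(\psi)$,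 the inner linearization $p_{\mathbf{X}}:\mathbb{R}^n\to\mathbb{R}\cup\{+\infty\}$ of $\psi$ is \[ p_{\mathbf{X}}(x)=\min\Big\{\sum_{i=1}^M\lambda_i y_i:\ \lambda_i\geq 0,\ \sum_{i=1}^M\lambda_i=1,\ \sum_{i=1}^M\lambda_i x_i=x\Big\} \] if $x\in\mathrm{conv}\{x_1,\ldots,x_M\}$, and $p_{\mathbf{X}}(x)=+\infty$ otherwise. A point $x$ is a break point of $p_{\mathbf{X}}$ if $(x,y)$ is an extreme point of $\mathrm{epi}(p_{\mathbf{X}})$ for some $y\in\mathbb{R}$. $\mathscr{C}_N(\psi)$ denotes the set of all inner linearizations of $\psi$ with at most $N$ break points, and for $f=e^{-\psi}\in\mathrm{LC}_{\rm c}(\mathbb{R}^n)$, $\mathscr{P}_N(f):=\{e^{-p}:p\in\mathscr{C}_N(\psi)\}$ (the inner log-linearizations of $f$ with at most $N$ break points). **Symmetric decreasing rearrangement.** For a measurable set $A\subset\mathbb{R}^n$ of finite volume, $B_A$ is the closed Euclidean ball centered at the origin with the same volume as $A$ (with $B_A=\{o\}$ if $A$ is nonempty of volume zero, and $B_\varnothing=\varnothing$). For $f\in\mathrm{LC}_{\rm c}(\mathbb{R}^n)$, $f^*:\mathbb{R}^n\to[0,\infty)$ is the function with $\{x: f^*(x)\geq t\}=B_{\{x:f(x)\geq t\}}$ for all $t>0$; one has $f^*\in\mathrm{LC}_{\rm c}(\mathbb{R}^n)$. *)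

theory Defs
  imports "HOL-Analysis.Analysis"
begin

definition eff_dom :: "(real^'n \<Rightarrow> ereal) \<Rightarrow> (real^'n) set" where
  "eff_dom \<psi> = {x. \<psi> x < \<infinity>}"

definition epi :: "(real^'n \<Rightarrow> ereal) \<Rightarrow> ((real^'n) \<times> real) set" where
  "epi \<psi> = {(x, t). ereal t \<ge> \<psi> x}"

(* The weights are strictly positive, so the convention 0 * \<infinity> = 0 on ereal plays no role. *)
definition convex_fun :: "(real^'n \<Rightarrow> ereal) \<Rightarrow> bool" where
  "convex_fun \<psi> \<longleftrightarrow> (\<forall>x. \<psi> x \<noteq> -\<infinity>) \<and>
     (\<forall>x y t. 0 < t \<and> t < 1 \<longrightarrow>
        \<psi> ((1 - t) *\<^sub>R x + t *\<^sub>R y) \<le> ereal (1 - t) * \<psi> x + ereal t * \<psi> y)"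

definition Conv_c :: "(real^'n \<Rightarrow> ereal) set" where
  "Conv_c = {\<psi>. convex_fun \<psi> \<and> (\<psi> \<longlongrightarrow> \<infinity>) at_infinity \<and> closed (epi \<psi>) \<and>
     (\<exists>x. \<psi> x \<noteq> \<infinity>) \<and> 0 \<in> eff_dom \<psi> \<and>
     \<not> (\<exists>a b. a \<noteq> 0 \<and> eff_dom \<psi> \<subseteq> {x. a \<bullet> x = b})}"

(* e^{-\<psi>}, with e^{-\<infinity>} = 0; only used for \<psi> that avoid -\<infinity>. *)
definition exp_neg :: "(real^'n \<Rightarrow> ereal) \<Rightarrow> real^'n \<Rightarrow> real" where
  "exp_neg \<psi> x = (if \<psi> x = \<infinity> then 0 else exp (- real_of_ereal (\<psi> x)))"

definition LC_c :: "(real^'n \<Rightarrow> real) set" where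
  "LC_c = exp_neg ` Conv_c"

definition total_mass :: "(real^'n \<Rightarrow> real) \<Rightarrow> real" where
  "total_mass f = (LINT x|lebesgue. f x)"

definition comb_values :: "((real^'n) \<times> real) set \<Rightarrow> real^'n \<Rightarrow> real set" where
  "comb_values X x = {\<Sum>p\<in>X. w p * snd p | w.
     (\<forall>p\<in>X. 0 \<le> w p) \<and> (\<Sum>p\<in>X. w p) = 1 \<and> (\<Sum>p\<in>X. w p *\<^sub>R fst p) = x}"

(* For finite X and x in the convex hull the infimum is a minimum, see inner_lin_attained. *)
definition inner_lin :: "((real^'n) \<times> real) set \<Rightarrow> real^'n \<Rightarrow> ereal" where
  "inner_lin X x =
     (if x \<in> convex hull (fst ` X) then ereal (Inf (comb_values X x)) else \<infinity>)"

lemma comb_values_eq: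
  fixes X :: "((real^'n) \<times> real) set"
  assumes "finite X"
  shows "comb_values X x = {y. (x, y) \<in> convex hull X}"
proof -
  have "(\<Sum>p\<in>X. w p *\<^sub>R p) = (\<Sum>p\<in>X. w p *\<^sub>R fst p, \<Sum>p\<in>X. w p * snd p)"
    for w :: "(real^'n) \<times> real \<Rightarrow> real"
    by (simp add: prod_eq_iff fst_sum snd_sum)
  then show ?thesis
    unfolding comb_values_def convex_hull_finite[OF assms] by auto
qed

lemma inner_lin_attained:
  assumes X: "finite X" and x: "x \<in> convex hull (fst ` X)"
  shows "Inf (comb_values X x) \<in> comb_values X x \<and>
    (\<forall>y\<in>comb_values X x. Inf (comb_values X x) \<le> y)"
proof -
  have "x \<in> fst ` (convex hull X)"
    using x convex_hull_linear_image[OF linear_fst, of X] by simp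
  then have ne: "comb_values X x \<noteq> {}"
    by (force simp: comb_values_eq[OF X])
  have c: "compact (convex hull X)"
    using X by (simp add: finite_imp_compact_convex_hull)
  have eq: "comb_values X x = snd ` (convex hull X \<inter> fst -` {x})"
    by (force simp: comb_values_eq[OF X])
  have "compact (comb_values X x)"
    unfolding eq
    by (intro compact_continuous_image compact_Int_closed c continuous_intros
        continuous_closed_vimage)
  then show ?thesis
    using ne closed_contains_Inf[of "comb_values X x"] cInf_lower[of _ "comb_values X x"]
    by (auto simp: compact_eq_bounded_closed bounded_imp_bdd_below)
qed

definition break_points :: "(real^'n \<Rightarrow> ereal) \<Rightarrow> (real^'n) set" where
  "break_points p = {x. \<exists>y. (x, y) extreme_point_of (epi p)}"

definition inner_linearizations :: "nat \<Rightarrow> (real^'n \<Rightarrow> ereal) \<Rightarrow> (real^'n \<Rightarrow> ereal) set" where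
  "inner_linearizations N \<psi> = {inner_lin X | X. finite X \<and> X \<noteq> {} \<and> X \<subseteq> epi \<psi> \<and>
     finite (break_points (inner_lin X)) \<and> card (break_points (inner_lin X)) \<le> N}"

(* The representing \<psi> of f is unique. *)
definition inner_log_linearizations :: "nat \<Rightarrow> (real^'n \<Rightarrow> real) \<Rightarrow> (real^'n \<Rightarrow> real) set" where
  "inner_log_linearizations N f =
     {exp_neg p | p \<psi>. \<psi> \<in> Conv_c \<and> f = exp_neg \<psi> \<and> p \<in> inner_linearizations N \<psi>}"

definition G :: "nat \<Rightarrow> (real^'n \<Rightarrow> real) \<Rightarrow> real" where
  "G N f = (INF p\<in>inner_log_linearizations N f. total_mass f - total_mass p)"

(* A nonempty null set has radius 0, hence is sent to cball 0 0 = {0}. *)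
definition sym_ball :: "(real^'n) set \<Rightarrow> (real^'n) set" where
  "sym_ball A = (if A = {} then {} else
     cball 0 (THE r. 0 \<le> r \<and> measure lebesgue (cball 0 r :: (real^'n) set) = measure lebesgue A))"

definition sym_rearr :: "(real^'n \<Rightarrow> real) \<Rightarrow> real^'n \<Rightarrow> real" where
  "sym_rearr f = (THE g. (\<forall>x. 0 \<le> g x) \<and> (\<forall>t>0. {x. g x \<ge> t} = sym_ball {x. f x \<ge> t}))"

end

theory Submission
  imports Defs
begin

text \<open>
  Total mass is invariant under rearrangement, so it is to be shown that every log-linearization of
  the rearranged function, spanned by at most \<open>N\<close> points of its epigraph, is matched in mass, up to
  an arbitrarily small loss, by a log-linearization of \<open>f = exp (- \<psi>)\<close> spanned by as many points.

  Fix the heights \<open>y i\<close> of the points. A point \<open>(x i, y i)\<close> belongs to the epigraph of \<open>\<psi>\<close> iff \<open>x i\<close>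
  belongs to the sublevel set \<open>L i\<close> of \<open>\<psi>\<close> at height \<open>y i\<close>, a convex body; for the rearranged
  function \<open>L i\<close> is replaced by the ball of the same volume. So the question is about a function of
  finitely many points, the mass of the inner log-linearization that they span, which is to be
  maximized over a product of convex bodies or over the product of the corresponding balls. As in
  Macbeath's theorem on inscribed polytopes, two facts settle it.

  One concerns the points: if they all move parallel to a common direction, the volume of each sublevel set of the
  inner linearization is a convex function of the displacement (\<open>sublevel_steiner\<close>). A point of
  the Steiner symmetral of \<open>L i\<close> is the midpoint of a point of \<open>L i\<close> and the mirror image of another
  one on the same line. Hence a system of points in the symmetrals has at most the mass of one of
  two systems in the original bodies (\<open>hull_mass_steiner\<close>).

  The other concerns the bodies: finitely many Steiner symmetrizations, applied to all bodies simultaneously, make each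
  body contain the ball of its volume shrunk by a factor \<open>1 - e\<close> (\<open>exists_steiner_nearly_round\<close>).
  Shrinking the points of a system costs only the factor \<open>(1 - e) ^ n\<close> in mass. Together
  this gives \<open>exists_hull_mass_ge_balls\<close>.

  It remains to see that the infimum for the rearranged function is taken over a nonempty set and
  the one for \<open>f\<close> over a set that is bounded below. The latter holds because functions of the class
  decay exponentially (\<open>nn_integral_exp_neg_finite\<close>). For the former, the rearranged function must
  itself belong to the class. Its convexity is the Brunn-Minkowski inequality, which the
  simultaneous symmetrization also yields (\<open>brunn_minkowski_radius\<close>). Finally, a bound on
  the number of break points has to be translated into a bound on the number of spanning points
  (\<open>inner_lin_reduce\<close>).
\<close>

section \<open>Integration along parallel lines\<close>

lemma nn_integral_lborel_translate:
  fixes h :: "'a::euclidean_space \<Rightarrow> ennreal"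
  assumes [measurable]: "h \<in> borel_measurable borel"
  shows "(\<integral>\<^sup>+x. h (x + c) \<partial>lborel) = (\<integral>\<^sup>+x. h x \<partial>lborel)"
proof -
  have "(\<integral>\<^sup>+x. h x \<partial>lborel) = (\<integral>\<^sup>+x. h x \<partial>(distr lborel borel ((+) c)))"
    by (simp add: lborel_distr_plus)
  also have "\<dots> = (\<integral>\<^sup>+x. h (c + x) \<partial>lborel)"
    by (rule nn_integral_distr) auto
  finally show ?thesis by (simp add: add.commute)
qed

text \<open>Fubini along a direction without choosing coordinates. Averaging the translates
  of \<open>h\<close> along \<open>u\<close> over the slab \<open>0 \<le> x \<bullet> u < 1\<close> counts every point of the space with weight
  one, because exactly a unit interval of translations carries a given point into the slab. The
  slab stands in for the hyperplane orthogonal to \<open>u\<close> and its lower-dimensional measure.\<close>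

lemma nn_integral_along_lines:
  fixes h :: "'a::euclidean_space \<Rightarrow> ennreal"
  assumes h [measurable]: "h \<in> borel_measurable borel" and u: "norm u = 1"
  shows "(\<integral>\<^sup>+x. h x \<partial>lborel) =
    (\<integral>\<^sup>+x. indicator {x. 0 \<le> x \<bullet> u \<and> x \<bullet> u < 1} x * (\<integral>\<^sup>+t. h (x + t *\<^sub>R u) \<partial>lborel) \<partial>lborel)"
proof -
  define D where "D = {x::'a. 0 \<le> x \<bullet> u \<and> x \<bullet> u < 1}"
  have [measurable]: "D \<in> sets borel" unfolding D_def by measurable
  have uu: "u \<bullet> u = 1" using u by (simp add: dot_square_norm)
  have "(\<integral>\<^sup>+x. indicator D x * (\<integral>\<^sup>+t. h (x + t *\<^sub>R u) \<partial>lborel) \<partial>lborel)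
      = (\<integral>\<^sup>+x. (\<integral>\<^sup>+t. indicator D x * h (x + t *\<^sub>R u) \<partial>lborel) \<partial>lborel)"
    by (subst nn_integral_cmult) auto
  also have "\<dots> = (\<integral>\<^sup>+t. (\<integral>\<^sup>+x. indicator D x * h (x + t *\<^sub>R u) \<partial>lborel) \<partial>lborel)"
    by (rule lborel_pair.Fubini'[symmetric]) simp
  also have "\<dots> = (\<integral>\<^sup>+t. (\<integral>\<^sup>+x. indicator D (x - t *\<^sub>R u) * h x \<partial>lborel) \<partial>lborel)"
  proof (rule nn_integral_cong)
    fix t :: real
    show "(\<integral>\<^sup>+x. indicator D x * h (x + t *\<^sub>R u) \<partial>lborel)
        = (\<integral>\<^sup>+x. indicator D (x - t *\<^sub>R u) * h x \<partial>lborel)"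
      using nn_integral_lborel_translate[of "\<lambda>x. indicator D (x - t *\<^sub>R u) * h x" "t *\<^sub>R u"]
      by simp
  qed
  also have "\<dots> = (\<integral>\<^sup>+x. (\<integral>\<^sup>+t. indicator D (x - t *\<^sub>R u) * h x \<partial>lborel) \<partial>lborel)"
    by (rule lborel_pair.Fubini') simp
  also have "\<dots> = (\<integral>\<^sup>+x. h x \<partial>lborel)"
  proof (rule nn_integral_cong)
    fix x :: 'a
    have "(\<integral>\<^sup>+t. indicator D (x - t *\<^sub>R u) * h x \<partial>lborel)
        = (\<integral>\<^sup>+t. indicator {x \<bullet> u - 1 <.. x \<bullet> u} t * h x \<partial>lborel)"
      by (intro nn_integral_cong) (auto simp: D_def indicator_def algebra_simps uu)
    also have "\<dots> = h x" by (subst nn_integral_multc) auto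
    finally show "(\<integral>\<^sup>+t. indicator D (x - t *\<^sub>R u) * h x \<partial>lborel) = h x" .
  qed
  finally show ?thesis by (simp add: D_def)
qed

text \<open>The form in which Fubini is used: an inequality between integrals may be checked
  line by line, and each line may be parametrized from its foot on the hyperplane orthogonal to
  \<open>u\<close>, since the one-dimensional integrals are translation invariant.\<close>

lemma nn_integral_mono_lines:
  fixes h k :: "'a::euclidean_space \<Rightarrow> ennreal"
  assumes h [measurable]: "h \<in> borel_measurable borel" and k [measurable]: "k \<in> borel_measurable borel"
    and u: "norm u = 1"
    and le: "\<And>x. x \<bullet> u = 0 \<Longrightarrow>
      (\<integral>\<^sup>+t. h (x + t *\<^sub>R u) \<partial>lborel) \<le> (\<integral>\<^sup>+t. k (x + t *\<^sub>R u) \<partial>lborel)"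
  shows "(\<integral>\<^sup>+x. h x \<partial>lborel) \<le> (\<integral>\<^sup>+x. k x \<partial>lborel)"
proof -
  have uu: "u \<bullet> u = 1" using u by (simp add: dot_square_norm)
  have foot: "(\<integral>\<^sup>+t. g (x + t *\<^sub>R u) \<partial>lborel) = (\<integral>\<^sup>+t. g ((x - (x \<bullet> u) *\<^sub>R u) + t *\<^sub>R u) \<partial>lborel)"
    if [measurable]: "g \<in> borel_measurable borel" for g :: "'a \<Rightarrow> ennreal" and x
    using nn_integral_lborel_translate[of "\<lambda>t. g ((x - (x \<bullet> u) *\<^sub>R u) + t *\<^sub>R u)" "x \<bullet> u"]
    by (simp add: algebra_simps)
  have "(\<integral>\<^sup>+t. h (x + t *\<^sub>R u) \<partial>lborel) \<le> (\<integral>\<^sup>+t. k (x + t *\<^sub>R u) \<partial>lborel)" for x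
    unfolding foot[OF h, of x] foot[OF k, of x] by (rule le) (simp add: inner_diff_left uu)
  then have "indicator {x. 0 \<le> x \<bullet> u \<and> x \<bullet> u < 1} x * (\<integral>\<^sup>+t. h (x + t *\<^sub>R u) \<partial>lborel)
      \<le> indicator {x. 0 \<le> x \<bullet> u \<and> x \<bullet> u < 1} x * (\<integral>\<^sup>+t. k (x + t *\<^sub>R u) \<partial>lborel)" for x
    by (rule mult_left_mono) simp
  then show ?thesis
    unfolding nn_integral_along_lines[OF h u] nn_integral_along_lines[OF k u]
    by (rule nn_integral_mono)
qed

section \<open>Steiner symmetrization\<close>

text \<open>On every line parallel to \<open>u\<close> the chord \<open>I\<close> of \<open>K\<close> is replaced by \<open>(I - I) / 2\<close>, which for an
  interval is the interval of the same length centred at the hyperplane orthogonal to \<open>u\<close>.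
  Describing it by pairs of points of the same chord avoids speaking of chord lengths.\<close>

definition steiner :: "'a::euclidean_space \<Rightarrow> 'a set \<Rightarrow> 'a set" where
  "steiner u K = {p + ((s - s') / 2) *\<^sub>R u | p s s'. p \<bullet> u = 0 \<and> p + s *\<^sub>R u \<in> K \<and> p + s' *\<^sub>R u \<in> K}"

text \<open>A Steiner symmetral is a linear image of the set of pairs of points of \<open>K\<close> that lie
  on a common line parallel to \<open>u\<close>. Compactness and convexity are inherited for this reason.\<close>

lemma steiner_eq_image:
  assumes u: "norm u = 1"
  shows "steiner u K =
    (\<lambda>z. fst z - (fst z \<bullet> u) *\<^sub>R u + ((fst z \<bullet> u - snd z \<bullet> u) / 2) *\<^sub>R u) `
      (K \<times> K \<inter> {z. (fst z - (fst z \<bullet> u) *\<^sub>R u) - (snd z - (snd z \<bullet> u) *\<^sub>R u) = 0})"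
    (is "_ = ?f ` ?S")
proof (intro equalityI subsetI)
  have uu: "u \<bullet> u = 1" using u by (simp add: dot_square_norm)
  fix x assume "x \<in> steiner u K"
  then obtain p s s' where *: "x = p + ((s - s') / 2) *\<^sub>R u" "p \<bullet> u = 0"
    "p + s *\<^sub>R u \<in> K" "p + s' *\<^sub>R u \<in> K" by (auto simp: steiner_def)
  have "x = ?f (p + s *\<^sub>R u, p + s' *\<^sub>R u)" "(p + s *\<^sub>R u, p + s' *\<^sub>R u) \<in> ?S"
    using * by (auto simp: inner_add_left uu)
  then show "x \<in> ?f ` ?S" by blast
next
  have uu: "u \<bullet> u = 1" using u by (simp add: dot_square_norm)
  fix x assume "x \<in> ?f ` ?S"
  then obtain a b where *: "x = ?f (a, b)" "a \<in> K" "b \<in> K"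
    "a - (a \<bullet> u) *\<^sub>R u = b - (b \<bullet> u) *\<^sub>R u" by auto
  define p where "p = a - (a \<bullet> u) *\<^sub>R u"
  have "p \<bullet> u = 0" "p + (a \<bullet> u) *\<^sub>R u = a" "p + (b \<bullet> u) *\<^sub>R u = b"
    by (simp add: p_def inner_diff_left uu, simp add: p_def, simp add: p_def *(4))
  with * show "x \<in> steiner u K" by (force simp: steiner_def p_def)
qed

lemma compact_steiner: assumes "norm u = 1" "compact K" shows "compact (steiner u K)"
  unfolding steiner_eq_image[OF assms(1)]
  by (intro compact_continuous_image compact_Int_closed compact_Times assms continuous_intros
      closed_Collect_eq) auto

lemma convex_steiner: assumes "norm u = 1" "convex K" shows "convex (steiner u K)"
  unfolding steiner_eq_image[OF assms(1)]
proof (rule convex_linear_image)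
  show "linear (\<lambda>z. fst z - (fst z \<bullet> u) *\<^sub>R u + ((fst z \<bullet> u - snd z \<bullet> u) / 2) *\<^sub>R u)"
    by (rule linearI) (auto simp: algebra_simps add_divide_distrib diff_divide_distrib)
  have lin: "linear (\<lambda>z. (fst z - (fst z \<bullet> u) *\<^sub>R u) - (snd z - (snd z \<bullet> u) *\<^sub>R u))"
    by (rule linearI) (auto simp: algebra_simps)
  have eq: "{z. (fst z - (fst z \<bullet> u) *\<^sub>R u) - (snd z - (snd z \<bullet> u) *\<^sub>R u) = 0} =
      (\<lambda>z. (fst z - (fst z \<bullet> u) *\<^sub>R u) - (snd z - (snd z \<bullet> u) *\<^sub>R u)) -` {0}" by auto
  show "convex (K \<times> K \<inter> {z. (fst z - (fst z \<bullet> u) *\<^sub>R u) - (snd z - (snd z \<bullet> u) *\<^sub>R u) = 0})"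
    unfolding eq by (intro convex_Int convex_Times assms convex_linear_vimage lin) auto
qed

text \<open>The pair of a point with itself is sent to its projection; this is how a sequence of
  symmetrizations drives bodies towards the origin.\<close>

lemma projection_in_steiner:
  assumes "norm u = 1" "x \<in> K" shows "x - (x \<bullet> u) *\<^sub>R u \<in> steiner u K"
proof -
  have uu: "u \<bullet> u = 1" using assms by (simp add: dot_square_norm)
  show ?thesis unfolding steiner_def
    by (rule CollectI, rule exI[of _ "x - (x \<bullet> u) *\<^sub>R u"], rule exI[of _ "x \<bullet> u"],
        rule exI[of _ "x \<bullet> u"]) (use assms in \<open>auto simp: inner_diff_left uu\<close>)
qed

text \<open>Each point of the symmetral is the midpoint of a point of \<open>K\<close> and the mirror image of
  another one, and balls about the origin are convex and invariant under reflections.\<close>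

lemma steiner_subset_cball:
  assumes "norm u = 1" "K \<subseteq> cball 0 R" shows "steiner u K \<subseteq> cball 0 R"
proof
  have uu: "u \<bullet> u = 1" using assms by (simp add: dot_square_norm)
  fix x assume "x \<in> steiner u K"
  then obtain p s s' where *: "x = p + ((s - s') / 2) *\<^sub>R u" "p \<bullet> u = 0"
    "p + s *\<^sub>R u \<in> K" "p + s' *\<^sub>R u \<in> K" by (auto simp: steiner_def)
  have n: "norm (p + t *\<^sub>R u) = norm (p - t *\<^sub>R u)" for t
    using *(2) by (simp add: norm_eq_sqrt_inner inner_simps inner_commute uu)
  have "x = (1/2) *\<^sub>R (p + s *\<^sub>R u) + (1/2) *\<^sub>R (p - s' *\<^sub>R u)"
    unfolding *(1) by (simp add: algebra_simps diff_divide_distrib flip: scaleR_2)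
  then have "norm x \<le> 1/2 * norm (p + s *\<^sub>R u) + 1/2 * norm (p - s' *\<^sub>R u)"
    using norm_triangle_ineq[of "(1/2) *\<^sub>R (p + s *\<^sub>R u)" "(1/2) *\<^sub>R (p - s' *\<^sub>R u)"] by simp
  also have "\<dots> \<le> 1/2 * R + 1/2 * R"
    using assms(2) *(3,4) n[of s'] by (intro add_mono mult_left_mono) auto
  finally show "x \<in> cball 0 R" by simp
qed

lemma line_slice:
  fixes K :: "'a::euclidean_space set"
  assumes u: "norm u = 1" and K: "compact K" "convex K"
  obtains "{t. x + t *\<^sub>R u \<in> K} = {}" | a b :: real where "a \<le> b" "{t. x + t *\<^sub>R u \<in> K} = {a..b}"
proof -
  let ?I = "{t. x + t *\<^sub>R u \<in> K}"
  have inj: "inj (\<lambda>t. t *\<^sub>R u)" using u by (auto simp: inj_on_def)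
  have "closed ((\<lambda>t. x + t *\<^sub>R u) -` K)"
    by (intro closed_vimage compact_imp_closed K continuous_intros)
  then have cl: "closed ?I" by (simp add: vimage_def)
  obtain R where R: "\<And>y. y \<in> K \<Longrightarrow> norm y \<le> R"
    using compact_imp_bounded[OF K(1)] by (auto simp: bounded_iff)
  have "\<bar>t\<bar> \<le> R + norm x" if "t \<in> ?I" for t
  proof -
    have "\<bar>t\<bar> = norm ((x + t *\<^sub>R u) - x)" using u by simp
    also have "\<dots> \<le> norm (x + t *\<^sub>R u) + norm x" by (rule norm_triangle_ineq4)
    finally show ?thesis using R that by fastforce
  qed
  then have "bounded ?I" by (auto simp: bounded_iff)
  with cl have co: "compact ?I" by (simp add: compact_eq_bounded_closed)
  have "convex ?I"
  proof (rule convexI)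
    fix s t a b :: real assume "s \<in> ?I" "t \<in> ?I" and ab: "0 \<le> a" "0 \<le> b" "a + b = 1"
    then have "a *\<^sub>R (x + s *\<^sub>R u) + b *\<^sub>R (x + t *\<^sub>R u) \<in> K"
      using K(2) by (auto simp: convex_def)
    moreover have "a *\<^sub>R (x + s *\<^sub>R u) + b *\<^sub>R (x + t *\<^sub>R u) = x + (a *\<^sub>R s + b *\<^sub>R t) *\<^sub>R u"
      using ab(3) by (simp add: algebra_simps flip: scaleR_add_left)
    ultimately show "a *\<^sub>R s + b *\<^sub>R t \<in> ?I" by simp
  qed
  then have "connected ?I" by (rule convex_connected)
  with co obtain a b where ab: "?I = {a..b}"
    using connected_compact_interval_1[of ?I] by auto
  show thesis
  proof (cases "a \<le> b")
    case True then show ?thesis using that(2) ab by blast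
  next
    case False then show ?thesis using that(1) ab by auto
  qed
qed

lemma line_slice_nonempty:
  fixes K :: "'a::euclidean_space set"
  assumes "norm u = 1" "compact K" "convex K" "{t. x + t *\<^sub>R u \<in> K} \<noteq> {}"
  obtains a b :: real where "a \<le> b" "{t. x + t *\<^sub>R u \<in> K} = {a..b}"
  by (rule line_slice[OF assms(1-3), of x]) (simp_all only: assms(4) simp_thms)

lemma nn_integral_indicator_line:
  fixes K :: "'a::euclidean_space set"
  assumes [measurable]: "K \<in> sets borel"
  shows "(\<integral>\<^sup>+t. indicator K (x + t *\<^sub>R u) \<partial>lborel) = emeasure lborel {t. x + t *\<^sub>R u \<in> K}"
proof -
  have "(\<integral>\<^sup>+t. indicator K (x + t *\<^sub>R u) \<partial>lborel)
      = (\<integral>\<^sup>+t. indicator {t. x + t *\<^sub>R u \<in> K} t \<partial>lborel)"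
    by (intro nn_integral_cong) (auto simp: indicator_def)
  then show ?thesis by simp
qed

lemma emeasure_mono_lines:
  fixes K L :: "'a::euclidean_space set"
  assumes [measurable]: "K \<in> sets borel" "L \<in> sets borel" and u: "norm u = 1"
    and le: "\<And>x. x \<bullet> u = 0 \<Longrightarrow>
      emeasure lborel {t. x + t *\<^sub>R u \<in> K} \<le> emeasure lborel {t. x + t *\<^sub>R u \<in> L}"
  shows "emeasure lborel K \<le> emeasure lborel L"
proof -
  have "(\<integral>\<^sup>+x. indicator K x \<partial>lborel) \<le> (\<integral>\<^sup>+x. indicator L x \<partial>lborel)"
    by (rule nn_integral_mono_lines[OF _ _ u]) (simp_all add: nn_integral_indicator_line le)
  then show ?thesis by simp
qed

lemma steiner_slice:
  assumes u: "norm u = 1" and x: "x \<bullet> u = 0"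
  shows "{t. x + t *\<^sub>R u \<in> steiner u K} =
    {(s - s') / 2 | s s'. x + s *\<^sub>R u \<in> K \<and> x + s' *\<^sub>R u \<in> K}"
proof (intro equalityI subsetI)
  have uu: "u \<bullet> u = 1" using u by (simp add: dot_square_norm)
  fix t assume "t \<in> {t. x + t *\<^sub>R u \<in> steiner u K}"
  then obtain p s s' where *: "x + t *\<^sub>R u = p + ((s - s') / 2) *\<^sub>R u" "p \<bullet> u = 0"
    "p + s *\<^sub>R u \<in> K" "p + s' *\<^sub>R u \<in> K" by (auto simp: steiner_def)
  have "(x + t *\<^sub>R u) \<bullet> u = (p + ((s - s') / 2) *\<^sub>R u) \<bullet> u" using * by simp
  then have t: "t = (s - s') / 2" unfolding inner_add_left inner_scaleR_left uu x *(2) by simp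
  with * have "p = x" by simp
  with t * show "t \<in> {(s - s') / 2 | s s'. x + s *\<^sub>R u \<in> K \<and> x + s' *\<^sub>R u \<in> K}" by blast
next
  fix t assume "t \<in> {(s - s') / 2 | s s'. x + s *\<^sub>R u \<in> K \<and> x + s' *\<^sub>R u \<in> K}"
  then obtain s s' where "t = (s - s') / 2" "x + s *\<^sub>R u \<in> K" "x + s' *\<^sub>R u \<in> K" by blast
  with x show "t \<in> {t. x + t *\<^sub>R u \<in> steiner u K}" unfolding steiner_def by blast
qed

lemma steiner_slice_interval:
  fixes a b :: real
  assumes u: "norm u = 1" and x: "x \<bullet> u = 0" and I: "{t. x + t *\<^sub>R u \<in> K} = {a..b}"
  shows "{t. x + t *\<^sub>R u \<in> steiner u K} = {- (b - a) / 2 .. (b - a) / 2}"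
proof -
  have I': "x + t *\<^sub>R u \<in> K \<longleftrightarrow> a \<le> t \<and> t \<le> b" for t using I by auto
  show ?thesis unfolding steiner_slice[OF u x] I'
  proof (intro equalityI subsetI)
    fix t assume "t \<in> {- (b - a) / 2 .. (b - a) / 2}"
    then have "t = (((a + b) / 2 + t) - ((a + b) / 2 - t)) / 2"
      "a \<le> (a + b) / 2 + t \<and> (a + b) / 2 + t \<le> b" "a \<le> (a + b) / 2 - t \<and> (a + b) / 2 - t \<le> b"
      by (auto simp: field_simps)
    then show "t \<in> {(s - s') / 2 | s s'. (a \<le> s \<and> s \<le> b) \<and> (a \<le> s' \<and> s' \<le> b)}" by blast
  qed auto
qed

lemma steiner_slice_empty:
  assumes u: "norm u = 1" and x: "x \<bullet> u = 0" and I: "{t. x + t *\<^sub>R u \<in> K} = {}"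
  shows "{t. x + t *\<^sub>R u \<in> steiner u K} = {}"
  using I unfolding steiner_slice[OF u x] by auto

lemma emeasure_steiner:
  fixes K :: "'a::euclidean_space set"
  assumes u: "norm u = 1" and K: "compact K" "convex K"
  shows "emeasure lborel (steiner u K) = emeasure lborel K"
proof -
  have eq: "emeasure lborel {t. x + t *\<^sub>R u \<in> steiner u K} = emeasure lborel {t. x + t *\<^sub>R u \<in> K}"
    if x: "x \<bullet> u = 0" for x
    using u K
  proof (rule line_slice[where x = x])
    assume "{t. x + t *\<^sub>R u \<in> K} = {}"
    with steiner_slice_empty[OF u x this] show ?thesis by simp
  next
    fix a b :: real assume "a \<le> b" and I: "{t. x + t *\<^sub>R u \<in> K} = {a..b}"
    with steiner_slice_interval[OF u x I] show ?thesis
      by (simp add: field_simps)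
  qed
  have [measurable]: "K \<in> sets borel" "steiner u K \<in> sets borel"
    using compact_steiner[OF u K(1)] K by (auto intro: borel_compact)
  show ?thesis
    by (intro antisym emeasure_mono_lines[OF _ _ u]) (simp_all add: eq)
qed

lemma cball_slice:
  assumes u: "norm u = 1" and x: "x \<bullet> u = 0" and r: "0 \<le> r"
  obtains "{t. x + t *\<^sub>R u \<in> cball 0 r} = {}" | j where "0 \<le> j" "{t. x + t *\<^sub>R u \<in> cball 0 r} = {-j..j}"
proof (cases "norm x \<le> r")
  case nx: True
  have uu: "u \<bullet> u = 1" using u by (simp add: dot_square_norm)
  have "norm (x + t *\<^sub>R u) \<le> r \<longleftrightarrow> \<bar>t\<bar> \<le> sqrt (r\<^sup>2 - (norm x)\<^sup>2)" for t
  proof -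
    have "(norm (x + t *\<^sub>R u))\<^sup>2 = (norm x)\<^sup>2 + t\<^sup>2"
      unfolding power2_norm_eq_inner using x
      by (simp add: inner_simps inner_commute uu power2_eq_square)
    moreover have "norm (x + t *\<^sub>R u) \<le> r \<longleftrightarrow> (norm (x + t *\<^sub>R u))\<^sup>2 \<le> r\<^sup>2"
      using r by (simp add: power2_le_iff_abs_le)
    moreover have "t\<^sup>2 \<le> r\<^sup>2 - (norm x)\<^sup>2 \<longleftrightarrow> \<bar>t\<bar> \<le> sqrt (r\<^sup>2 - (norm x)\<^sup>2)"
      using real_sqrt_le_iff[of "t\<^sup>2" "r\<^sup>2 - (norm x)\<^sup>2"] by simp
    ultimately show ?thesis by linarith
  qed
  moreover define j where "j = sqrt (r\<^sup>2 - (norm x)\<^sup>2)"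
  ultimately have mem: "x + t *\<^sub>R u \<in> cball 0 r \<longleftrightarrow> - j \<le> t \<and> t \<le> j" for t
    by (simp only: mem_cball dist_0_norm abs_le_iff) linarith
  have "{t. x + t *\<^sub>R u \<in> cball 0 r} = {-j..j}" unfolding mem by (rule set_eqI) simp
  moreover have "0 \<le> j" using nx by (simp add: j_def power_mono)
  ultimately show ?thesis by (rule that(2)[rotated])
next
  case False
  have uu: "u \<bullet> u = 1" using u by (simp add: dot_square_norm)
  have "norm x \<le> norm (x + t *\<^sub>R u)" for t
  proof (rule power2_le_imp_le)
    show "(norm x)\<^sup>2 \<le> (norm (x + t *\<^sub>R u))\<^sup>2"
      unfolding power2_norm_eq_inner using x
      by (simp add: inner_simps inner_commute uu)
  qed simp
  then have "{t. x + t *\<^sub>R u \<in> cball 0 r} = {}" using False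
    by (metis (mono_tags, lifting) Collect_empty_eq dist_0_norm mem_cball order_trans)
  then show ?thesis by (rule that(1))
qed

text \<open>Symmetrization does not decrease the intersection with a centred ball \<open>B\<close>, and it
  gains the volume of the part of \<open>K - B\<close> that some translation along \<open>u\<close> moves into \<open>B - K\<close>.
  On a line let \<open>I\<close> and \<open>J\<close> be the chords of \<open>K\<close> and \<open>B\<close>. Before symmetrization they overlap in
  \<open>I \<inter> J\<close>; afterwards both are centred, hence nested, and overlap in the shorter of the two. Both
  \<open>I\<close> and \<open>J\<close> have room for \<open>I \<inter> J\<close> together with the translated piece.\<close>

lemma steiner_gain:
  fixes K :: "'a::euclidean_space set" and c r :: real
  assumes u: "norm u = 1" and K: "compact K" "convex K" and r: "0 \<le> r"
  defines "B \<equiv> cball 0 r"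
  shows "emeasure lborel (K \<inter> B) + emeasure lborel {x. x - c *\<^sub>R u \<in> K - B \<and> x \<in> B - K}
     \<le> emeasure lborel (steiner u K \<inter> B)"
proof -
  have [measurable]: "K \<in> sets borel" "steiner u K \<in> sets borel" "B \<in> sets borel"
    using compact_steiner[OF u K(1)] K by (auto intro: borel_compact simp: B_def)
  let ?E = "{x. x - c *\<^sub>R u \<in> K - B \<and> x \<in> B - K}"
  have [measurable]: "?E \<in> sets borel" by measurable
  have "(\<integral>\<^sup>+x. indicator (K \<inter> B) x + indicator ?E x \<partial>lborel)
      \<le> (\<integral>\<^sup>+x. indicator (steiner u K \<inter> B) x \<partial>lborel)"
  proof (rule nn_integral_mono_lines[OF _ _ u])
    fix x :: 'a assume x: "x \<bullet> u = 0"
    let ?I = "{t. x + t *\<^sub>R u \<in> K}" let ?J = "{t. x + t *\<^sub>R u \<in> B}"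
    let ?S = "{t. x + t *\<^sub>R u \<in> steiner u K}"
    let ?T = "{t. t - c \<in> ?I - ?J \<and> t \<in> ?J - ?I}"
    have [measurable]: "?I \<in> sets borel" "?J \<in> sets borel" "?S \<in> sets borel" by measurable
    have "(\<integral>\<^sup>+t. indicator (K \<inter> B) (x + t *\<^sub>R u) + indicator ?E (x + t *\<^sub>R u) \<partial>lborel)
        = (\<integral>\<^sup>+t. indicator (?I \<inter> ?J) t + indicator ?T t \<partial>lborel)"
      by (intro nn_integral_cong) (auto simp: indicator_def algebra_simps)
    also have "\<dots> = emeasure lborel (?I \<inter> ?J) + emeasure lborel ?T"
      by (subst nn_integral_add) auto
    finally have L: "(\<integral>\<^sup>+t. indicator (K \<inter> B) (x + t *\<^sub>R u) + indicator ?E (x + t *\<^sub>R u) \<partial>lborel)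
        = emeasure lborel (?I \<inter> ?J) + emeasure lborel ?T" .
    have "emeasure lborel (?I \<inter> ?J) + emeasure lborel ?T \<le> emeasure lborel (?I \<inter> ?J) + emeasure lborel (?J - ?I)"
      by (intro add_left_mono emeasure_mono) auto
    also have "\<dots> = emeasure lborel ?J"
      by (subst plus_emeasure) (auto intro: arg_cong[where f = "emeasure lborel"])
    finally have LJ: "emeasure lborel (?I \<inter> ?J) + emeasure lborel ?T \<le> emeasure lborel ?J" .
    have "emeasure lborel ?T \<le> emeasure lborel {t. t - c \<in> ?I - ?J}"
      by (intro emeasure_mono) auto
    also have "\<dots> = (\<integral>\<^sup>+t. indicator {t. t - c \<in> ?I - ?J} t \<partial>lborel)"
      by (rule nn_integral_indicator[symmetric]) simp
    also have "\<dots> = (\<integral>\<^sup>+t. indicator (?I - ?J) (t + - c) \<partial>lborel)"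
      by (intro nn_integral_cong) (auto simp: indicator_def)
    also have "\<dots> = emeasure lborel (?I - ?J)"
      by (subst nn_integral_lborel_translate) auto
    finally have "emeasure lborel (?I \<inter> ?J) + emeasure lborel ?T
        \<le> emeasure lborel (?I \<inter> ?J) + emeasure lborel (?I - ?J)" by (rule add_left_mono)
    also have "\<dots> = emeasure lborel ?I"
      by (subst plus_emeasure) (auto intro: arg_cong[where f = "emeasure lborel"])
    finally have LI: "emeasure lborel (?I \<inter> ?J) + emeasure lborel ?T \<le> emeasure lborel ?I" .
    have "(\<integral>\<^sup>+t. indicator (steiner u K \<inter> B) (x + t *\<^sub>R u) \<partial>lborel)
        = (\<integral>\<^sup>+t. indicator (?S \<inter> ?J) t \<partial>lborel)"
      by (intro nn_integral_cong) (auto simp: indicator_def)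
    also have "\<dots> = emeasure lborel (?S \<inter> ?J)" by (rule nn_integral_indicator) simp
    finally have R: "(\<integral>\<^sup>+t. indicator (steiner u K \<inter> B) (x + t *\<^sub>R u) \<partial>lborel) = emeasure lborel (?S \<inter> ?J)" .
    show "(\<integral>\<^sup>+t. indicator (K \<inter> B) (x + t *\<^sub>R u) + indicator ?E (x + t *\<^sub>R u) \<partial>lborel)
        \<le> (\<integral>\<^sup>+t. indicator (steiner u K \<inter> B) (x + t *\<^sub>R u) \<partial>lborel)"
      unfolding L R using u K
    proof (rule line_slice[where x = x])
      assume "?I = {}" then show "emeasure lborel (?I \<inter> ?J) + emeasure lborel ?T \<le> emeasure lborel (?S \<inter> ?J)"
        using LI by simp
    next
      fix a b :: real assume ab: "a \<le> b" and I: "?I = {a..b}"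
      have S: "?S = {- (b - a) / 2 .. (b - a) / 2}" by (rule steiner_slice_interval[OF u x I])
      have SI: "emeasure lborel ?S = emeasure lborel ?I"
        unfolding S I using ab by (simp add: field_simps)
      show "emeasure lborel (?I \<inter> ?J) + emeasure lborel ?T \<le> emeasure lborel (?S \<inter> ?J)"
        using u x r
      proof (rule cball_slice)
        assume "{t. x + t *\<^sub>R u \<in> cball 0 r} = {}"
        then have "?J = {}" by (simp add: B_def)
        then show ?thesis using LJ by simp
      next
        fix j assume j: "0 \<le> j" "{t. x + t *\<^sub>R u \<in> cball 0 r} = {-j..j}"
        then have J: "?J = {-j..j}" by (simp add: B_def)
        show ?thesis
        proof (cases "(b - a) / 2 \<le> j")
          case True
          then have "?S \<inter> ?J = ?S" unfolding S J by auto
          then show ?thesis using LI SI by simp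
        next
          case False
          then have "?S \<inter> ?J = ?J" unfolding S J by auto
          then show ?thesis using LJ by simp
        qed
      qed
    qed
  qed simp_all
  then show ?thesis by (subst (asm) nn_integral_add) auto
qed

text \<open>By Fubini, the overlap of a translate of \<open>A\<close> with \<open>C\<close>, integrated over all
  translation vectors, is the product of the volumes; only vectors of length at most \<open>2 * R\<close>
  contribute. So some overlap reaches the average. The summand \<open>1\<close> in the denominator makes the
  resulting estimate strict.\<close>

lemma exists_overlapping_translate:
  fixes A C :: "'a::euclidean_space set"
  assumes [measurable]: "A \<in> sets borel" "C \<in> sets borel"
    and R: "A \<subseteq> cball 0 R" "C \<subseteq> cball 0 R"
    and e: "0 < e" "ennreal e \<le> emeasure lborel A" "ennreal e \<le> emeasure lborel C"
  obtains z where
    "ennreal (e\<^sup>2 / (measure lborel (cball (0::'a) (2 * R)) + 1)) \<le> emeasure lborel {x. x - z \<in> A \<and> x \<in> C}"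
proof (rule ccontr)
  assume neg: "\<not> thesis"
  define V where "V = measure lborel (cball (0::'a) (2 * R))"
  define d where "d = e\<^sup>2 / (V + 1)"
  have V: "0 \<le> V" by (simp add: V_def)
  then have d: "0 < d" using e by (simp add: d_def add_nonneg_pos)
  have small: "emeasure lborel {x. x - z \<in> A \<and> x \<in> C} \<le> ennreal d * indicator (cball 0 (2 * R)) z" for z
  proof (cases "z \<in> cball 0 (2 * R)")
    case True
    have "\<not> ennreal d \<le> emeasure lborel {x. x - z \<in> A \<and> x \<in> C}"
      using that[of z] neg unfolding d_def V_def by blast
    with True show ?thesis by simp
  next
    case False
    have "{x. x - z \<in> A \<and> x \<in> C} = {}"
    proof (rule ccontr)
      assume "{x. x - z \<in> A \<and> x \<in> C} \<noteq> {}"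
      then obtain x where "x - z \<in> A" "x \<in> C" by blast
      then have "norm (x - z) \<le> R" "norm x \<le> R" using R by auto
      moreover have "norm z \<le> norm x + norm (x - z)"
        using norm_triangle_ineq4[of x "x - z"] by simp
      ultimately show False using False by simp
    qed
    then show ?thesis by (simp only: emeasure_empty zero_le)
  qed
  have "emeasure lborel A * emeasure lborel C = (\<integral>\<^sup>+x. emeasure lborel A * indicator C x \<partial>lborel)"
    by (simp add: nn_integral_cmult_indicator)
  also have "\<dots> = (\<integral>\<^sup>+x. (\<integral>\<^sup>+z. indicator A (x - z) * indicator C x \<partial>lborel) \<partial>lborel)"
  proof (rule nn_integral_cong)
    fix x :: 'a
    have "(\<integral>\<^sup>+z. indicator A (x - z) \<partial>lborel) = (\<integral>\<^sup>+z. indicator A z \<partial>(distr lborel borel (\<lambda>z. x - z)))"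
      by (rule nn_integral_distr[symmetric]) auto
    also have "distr lborel borel (\<lambda>z::'a. x - z) = lborel"
      using lborel_affine[of "-1" x] lborel_affine_euclidean[of "\<lambda>_. -1" x]
      by (simp add: sum_negf euclidean_representation density_1)
    finally have "(\<integral>\<^sup>+z. indicator A (x - z) \<partial>lborel) = emeasure lborel A" by simp
    then show "emeasure lborel A * indicator C x = (\<integral>\<^sup>+z. indicator A (x - z) * indicator C x \<partial>lborel)"
      by (subst nn_integral_multc) auto
  qed
  also have "\<dots> = (\<integral>\<^sup>+z. (\<integral>\<^sup>+x. indicator A (x - z) * indicator C x \<partial>lborel) \<partial>lborel)"
    by (rule lborel_pair.Fubini') simp
  also have "\<dots> = (\<integral>\<^sup>+z. emeasure lborel {x. x - z \<in> A \<and> x \<in> C} \<partial>lborel)"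
  proof (rule nn_integral_cong)
    fix z :: 'a
    have "(\<integral>\<^sup>+x. indicator A (x - z) * indicator C x \<partial>lborel)
        = (\<integral>\<^sup>+x. indicator {x. x - z \<in> A \<and> x \<in> C} x \<partial>lborel)"
      by (intro nn_integral_cong) (auto simp: indicator_def)
    then show "(\<integral>\<^sup>+x. indicator A (x - z) * indicator C x \<partial>lborel) = emeasure lborel {x. x - z \<in> A \<and> x \<in> C}"
      by simp
  qed
  also have "\<dots> \<le> (\<integral>\<^sup>+z. ennreal d * indicator (cball 0 (2 * R)) z \<partial>(lborel::'a measure))"
    by (intro nn_integral_mono small)
  also have "\<dots> = ennreal d * emeasure lborel (cball (0::'a) (2 * R))"
    by (subst nn_integral_cmult_indicator) auto
  also have "emeasure lborel (cball (0::'a) (2 * R)) = ennreal V"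
    unfolding V_def by (intro emeasure_eq_ennreal_measure) (use emeasure_lborel_cball_finite[of "0::'a" "2*R"] in auto)
  also have "ennreal d * ennreal V < ennreal (e\<^sup>2)"
  proof -
    have "d * V < e\<^sup>2" using V e(1) by (simp add: d_def field_simps)
    then show ?thesis using d V e(1) by (simp add: ennreal_mult[symmetric] ennreal_lessI)
  qed
  finally have "emeasure lborel A * emeasure lborel C < ennreal (e\<^sup>2)" .
  moreover have "ennreal (e\<^sup>2) \<le> emeasure lborel A * emeasure lborel C"
    using mult_mono[OF e(2,3)] e(1) by (simp add: power2_eq_square ennreal_mult)
  ultimately show False by simp
qed

section \<open>Rounding several convex bodies at once\<close>

text \<open>If a convex body misses a point of the slightly smaller ball, a hyperplane
  separates them and the body misses a whole small ball of radius \<open>e * r / 2\<close> inside the large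
  ball. So a body that fills the large ball up to less than that volume contains the smaller
  ball.\<close>

lemma convex_superset_cball:
  fixes K :: "'a::euclidean_space set"
  assumes K: "compact K" "convex K" "0 \<in> K" and r: "0 \<le> r" and e: "0 < e" "e < 1"
    and small: "0 < r \<Longrightarrow> measure lborel (cball 0 r - K) < measure lborel (cball (0::'a) (e * r / 2))"
  shows "cball 0 ((1 - e) * r) \<subseteq> K"
proof (rule subsetI, rule ccontr)
  fix q assume q: "q \<in> cball 0 ((1 - e) * r)" "q \<notin> K"
  have "r \<noteq> 0" using q K(3) by auto
  with r have r: "0 < r" by simp
  obtain a b where ab: "a \<bullet> q < b" "\<And>x. x \<in> K \<Longrightarrow> b < a \<bullet> x"
    using separating_hyperplane_closed_point[OF K(2) compact_imp_closed[OF K(1)] q(2)] by blast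
  have a0: "a \<noteq> 0" using ab(1) ab(2)[OF K(3)] by auto
  define w where "w = (1 / norm a) *\<^sub>R a"
  have w: "norm w = 1" "a \<bullet> w = norm a" using a0
    by (simp_all add: w_def dot_square_norm power2_eq_square)
  \<comment> \<open>The ball about \<open>c\<close> touches the hyperplane through \<open>q\<close> from the side away from \<open>K\<close>.\<close>
  define c where "c = q - (e * r / 2) *\<^sub>R w"
  have "cball c (e * r / 2) \<subseteq> cball 0 r - K"
  proof
    fix x assume x: "x \<in> cball c (e * r / 2)"
    then have n: "norm (x - c) \<le> e * r / 2" by (simp add: dist_norm norm_minus_commute)
    have "norm x = norm (q + (- ((e * r / 2) *\<^sub>R w) + (x - c)))" by (simp add: c_def)
    also have "\<dots> \<le> norm q + (norm ((e * r / 2) *\<^sub>R w) + norm (x - c))"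
      by (metis add_left_mono norm_minus_cancel norm_triangle_ineq norm_triangle_le)
    also have "\<dots> \<le> (1 - e) * r + (e * r / 2 + e * r / 2)"
      using q(1) n e r w by (intro add_mono) auto
    also have "\<dots> = r" by (simp add: algebra_simps)
    finally have 1: "norm x \<le> r" .
    have "a \<bullet> x = a \<bullet> c + a \<bullet> (x - c)" by (simp add: inner_simps)
    also have "\<dots> \<le> a \<bullet> c + norm a * (e * r / 2)"
      using norm_cauchy_schwarz[of a "x - c"] n by (smt (verit) mult_left_mono norm_ge_zero)
    also have "\<dots> = a \<bullet> q" using w by (simp add: c_def inner_simps)
    finally have "a \<bullet> x < b" using ab(1) by simp
    then have "x \<notin> K" using ab(2) by force
    with 1 show "x \<in> cball 0 r - K" by simp
  qed
  then have "measure lborel (cball c (e * r / 2)) \<le> measure lborel (cball 0 r - K)"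
  proof (rule measure_mono_fmeasurable)
    show "cball 0 r - K \<in> fmeasurable lborel"
      using K by (intro fmeasurable_Diff) (simp_all add: fmeasurable_compact borel_compact)
  qed simp_all
  moreover have "measure lborel (cball c (e * r / 2)) = measure lborel (cball (0::'a) (e * r / 2))"
    using e r by (simp add: content_cball)
  ultimately show False using small r by simp
qed

text \<open>As long as \<open>K\<close> misses a part of volume \<open>e\<close> of the ball of its own volume, one
  symmetrization increases the intersection with that ball by an amount that depends only on \<open>e\<close>
  and the bounding radius: \<open>K - B\<close> and \<open>B - K\<close> have the same volume, some translate of the former
  overlaps the latter, and the direction of the translation serves as \<open>u\<close>.\<close>

lemma steiner_volume_gain:
  fixes K :: "'a::euclidean_space set"
  assumes K: "compact K" "convex K" and r: "0 \<le> r" "measure lborel (cball (0::'a) r) = measure lborel K"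
    and R: "K \<subseteq> cball 0 R" "r \<le> R" and e: "0 < e" "e \<le> measure lborel (cball 0 r - K)"
  obtains u where "norm u = 1"
    "measure lborel (K \<inter> cball 0 r) + e\<^sup>2 / (measure lborel (cball (0::'a) (2 * R)) + 1)
      \<le> measure lborel (steiner u K \<inter> cball 0 r)"
proof -
  let ?B = "cball (0::'a) r"
  define d where "d = e\<^sup>2 / (measure lborel (cball (0::'a) (2 * R)) + 1)"
  have d: "0 < d" using e by (simp add: d_def add_nonneg_pos)
  have [measurable]: "K \<in> sets borel" using K by (simp add: borel_compact)
  have fK: "K \<in> fmeasurable lborel" using K by (simp add: fmeasurable_compact)
  have fB: "?B \<in> fmeasurable lborel" by (simp add: fmeasurable_compact)
  have split: "measure lborel S = measure lborel (S - T) + measure lborel (S \<inter> T)"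
    if "S \<in> fmeasurable lborel" "T \<in> fmeasurable lborel" for S T :: "'a set"
  proof -
    have "measure lborel ((S - T) \<union> (S \<inter> T)) = measure lborel (S - T) + measure lborel (S \<inter> T)"
      using that fmeasurable_Diff[of S lborel T] fmeasurable_Int_fmeasurable[of S lborel T]
      by (intro measure_Union) (auto simp: fmeasurable_def)
    moreover have "(S - T) \<union> (S \<inter> T) = S" by blast
    ultimately show ?thesis by simp
  qed
  have "measure lborel (K - ?B) = measure lborel (?B - K)"
    using split[OF fK fB] split[OF fB fK] r(2) by (simp add: Int_commute)
  then have "ennreal e \<le> emeasure lborel (K - ?B)" "ennreal e \<le> emeasure lborel (?B - K)"
    using e fK fB by (auto simp: emeasure_eq_measure2 fmeasurable_Diff intro!: ennreal_leI)
  moreover have "K - ?B \<subseteq> cball 0 R" "?B - K \<subseteq> cball 0 R" using R by auto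
  ultimately obtain z where z: "ennreal d \<le> emeasure lborel {x. x - z \<in> K - ?B \<and> x \<in> ?B - K}"
    unfolding d_def
    by (rule_tac exists_overlapping_translate[of "K - ?B" "?B - K" R e]) (use e(1) in simp_all)
  have "z \<noteq> 0"
  proof
    assume "z = 0"
    then have "{x. x - z \<in> K - ?B \<and> x \<in> ?B - K} = {}" by auto
    with z have "ennreal d \<le> emeasure lborel ({} :: 'a set)" by (simp only:)
    with d show False by simp
  qed
  define u where "u = (1 / norm z) *\<^sub>R z"
  have u: "norm u = 1" "z = norm z *\<^sub>R u" using \<open>z \<noteq> 0\<close> by (simp_all add: u_def)
  have cS: "compact (steiner u K)" by (rule compact_steiner[OF u(1) K(1)])
  have "emeasure lborel (K \<inter> ?B) + ennreal d \<le> emeasure lborel (steiner u K \<inter> ?B)"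
    using add_left_mono[OF z, of "emeasure lborel (K \<inter> ?B)"]
      steiner_gain[OF u(1) K r(1), of "norm z"] unfolding u(2)[symmetric] by (rule order_trans)
  then have "ennreal (measure lborel (K \<inter> ?B) + d) \<le> ennreal (measure lborel (steiner u K \<inter> ?B))"
    using fK fB d cS by (simp add: emeasure_eq_measure2 fmeasurable.Int fmeasurable_compact ennreal_plus)
  then have "measure lborel (K \<inter> ?B) + d \<le> measure lborel (steiner u K \<inter> ?B)"
    by (simp add: ennreal_le_iff)
  then show thesis using that u(1) unfolding d_def by blast
qed

lemma steiner_Int_cball_mono:
  fixes K :: "'a::euclidean_space set"
  assumes u: "norm u = 1" and K: "compact K" "convex K" and r: "0 \<le> r"
  shows "measure lborel (K \<inter> cball 0 r) \<le> measure lborel (steiner u K \<inter> cball 0 r)"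
proof -
  have "emeasure lborel (K \<inter> cball 0 r) \<le> emeasure lborel (steiner u K \<inter> cball 0 r)"
    by (rule order_trans[OF _ steiner_gain[OF u K r, of 0]]) (rule add_increasing2, simp_all)
  then show ?thesis using K compact_steiner[OF u K(1)]
    by (simp add: emeasure_eq_measure2 fmeasurable.Int fmeasurable_compact)
qed

text \<open>A property of families of sets that survives symmetrizing all members in one common
  direction. Properties relating several bodies (an inclusion between Minkowski sums, or the
  comparison of masses below) are of this kind, so they can be carried to the limit of round
  bodies.\<close>

definition steiner_invariant :: "(('i \<Rightarrow> 'a::euclidean_space set) \<Rightarrow> bool) \<Rightarrow> bool" where
  "steiner_invariant P \<longleftrightarrow> (\<forall>K u. norm u = 1 \<longrightarrow> P K \<longrightarrow> P (\<lambda>i. steiner u (K i)))"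

lemma steiner_invariantD:
  "steiner_invariant P \<Longrightarrow> norm u = 1 \<Longrightarrow> P K \<Longrightarrow> P (\<lambda>i. steiner u (K i))"
  by (simp add: steiner_invariant_def)

lemma steiner_invariant_conj:
  "steiner_invariant P \<Longrightarrow> steiner_invariant Q \<Longrightarrow> steiner_invariant (\<lambda>K. P K \<and> Q K)"
  by (simp add: steiner_invariant_def)

lemma steiner_invariant_body:
  fixes v :: "'i \<Rightarrow> real"
  shows "steiner_invariant (\<lambda>K::'i \<Rightarrow> 'a::euclidean_space set. \<forall>i\<in>I. compact (K i) \<and> convex (K i) \<and>
    K i \<subseteq> cball 0 R \<and> measure lborel (K i) = v i)"
  unfolding steiner_invariant_def
proof (intro allI impI ballI)
  fix K :: "'i \<Rightarrow> 'a set" and u :: 'a and i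
  assume u: "norm u = 1" and i: "i \<in> I" and "\<forall>i\<in>I. compact (K i) \<and> convex (K i) \<and>
    K i \<subseteq> cball 0 R \<and> measure lborel (K i) = v i"
  then have K: "compact (K i)" "convex (K i)" "K i \<subseteq> cball 0 R" "measure lborel (K i) = v i" by blast+
  show "compact (steiner u (K i)) \<and> convex (steiner u (K i)) \<and>
    steiner u (K i) \<subseteq> cball 0 R \<and> measure lborel (steiner u (K i)) = v i"
    using compact_steiner[OF u K(1)] convex_steiner[OF u K(2)] steiner_subset_cball[OF u K(3)]
      emeasure_steiner[OF u K(1,2)] K(4) by (simp add: measure_def)
qed

text \<open>Symmetrizing in all coordinate directions in turn projects a point of each body to
  the origin. This matters for bodies of volume zero, whose limiting ball is \<open>{0}\<close>.\<close>

lemma exists_steiner_centered: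
  fixes K :: "'i \<Rightarrow> 'a::euclidean_space set"
  assumes P: "steiner_invariant P" "P K" and ne: "\<And>i. i \<in> I \<Longrightarrow> K i \<noteq> {}"
  obtains K' where "P K'" "\<And>i. i \<in> I \<Longrightarrow> 0 \<in> K' i"
proof -
  have "\<exists>K'. P K' \<and> (\<forall>i\<in>I. \<exists>x\<in>K' i. \<forall>b\<in>S. x \<bullet> b = 0)" if "finite S" "S \<subseteq> Basis" for S :: "'a set"
    using that
  proof (induction S)
    case empty then show ?case using P ne by blast
  next
    case (insert b S)
    then obtain K' where K': "P K'" "\<And>i. i \<in> I \<Longrightarrow> \<exists>x\<in>K' i. \<forall>c\<in>S. x \<bullet> c = 0" by auto
    have b: "norm b = 1" "b \<in> Basis" using insert.prems by auto
    have "\<exists>x\<in>steiner b (K' i). \<forall>c\<in>insert b S. x \<bullet> c = 0" if i: "i \<in> I" for i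
    proof -
      obtain x where x: "x \<in> K' i" "\<forall>c\<in>S. x \<bullet> c = 0" using K'(2)[OF i] by auto
      have "\<forall>c\<in>insert b S. (x - (x \<bullet> b) *\<^sub>R b) \<bullet> c = 0"
        using x(2) insert.hyps insert.prems
        by (auto simp: inner_diff_left inner_Basis subset_iff)
      then show ?thesis using projection_in_steiner[OF b(1) x(1)] by blast
    qed
    then show ?case using steiner_invariantD[OF P(1) b(1) K'(1)] by blast
  qed
  from this[of Basis] obtain K' where K': "P K'" "\<forall>i\<in>I. \<exists>x\<in>K' i. \<forall>b\<in>Basis. x \<bullet> b = 0" by auto
  then have "0 \<in> K' i" if "i \<in> I" for i
    using that by (metis euclidean_all_zero_iff)
  with K'(1) show thesis using that by blast
qed

text \<open>All members of a finite family of convex bodies can be rounded at once: after finitely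
  many common symmetrizations each contains almost the whole ball of its volume. The sum of the
  volumes of the intersections with these balls is bounded, and by the preceding estimates some
  symmetrization increases it by a fixed amount \<open>d\<close> whenever one body still misses too much of
  its ball; so this cannot go on forever.\<close>

theorem exists_steiner_nearly_round:
  fixes K :: "'i \<Rightarrow> 'a::euclidean_space set"
  assumes I: "finite I" and P: "steiner_invariant P" "P K"
    and K: "\<And>i. i \<in> I \<Longrightarrow> compact (K i) \<and> convex (K i) \<and> K i \<noteq> {}"
    and r: "\<And>i. i \<in> I \<Longrightarrow> 0 \<le> r i \<and> measure lborel (cball (0::'a) (r i)) = measure lborel (K i)"
    and e: "0 < e" "e < 1"
  obtains K' where "P K'" "\<And>i. i \<in> I \<Longrightarrow> compact (K' i) \<and> measure lborel (K' i) = measure lborel (K i)"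
    "\<And>i. i \<in> I \<Longrightarrow> cball 0 ((1 - e) * r i) \<subseteq> K' i"
proof -
  have "bounded (\<Union>i\<in>I. K i \<union> cball 0 (r i))"
    using I K by (auto simp: compact_imp_bounded)
  then obtain R where "\<forall>x\<in>(\<Union>i\<in>I. K i \<union> cball 0 (r i)). norm x \<le> R"
    by (auto simp only: bounded_iff)
  then have R: "(\<Union>i\<in>I. K i \<union> cball 0 (r i)) \<subseteq> cball 0 R"
    unfolding subset_iff mem_cball dist_0_norm by blast
  have rR: "r i \<le> R" if i: "i \<in> I" for i
  proof -
    obtain w :: 'a where w: "norm w = r i" using r[OF i] vector_choose_size by blast
    then have "w \<in> K i \<union> cball 0 (r i)" by simp
    with i R have "w \<in> cball 0 R" by blast
    then show ?thesis using w by simp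
  qed
  let ?body = "\<lambda>L. \<forall>i\<in>I. compact (L i) \<and> convex (L i) \<and> L i \<subseteq> cball 0 R \<and>
    measure lborel (L i) = measure lborel (K i)"
  let ?Q = "\<lambda>L. (P L \<and> ?body L) \<and> (\<forall>i\<in>I. 0 \<in> L i)"
  have inv: "steiner_invariant (\<lambda>L. P L \<and> ?body L)"
    by (intro steiner_invariant_conj P steiner_invariant_body)
  have "K i \<subseteq> cball 0 R" if "i \<in> I" for i using R that by blast
  with P(2) K have "P K \<and> ?body K" by blast
  then obtain K0 where "P K0 \<and> ?body K0" "\<And>i. i \<in> I \<Longrightarrow> 0 \<in> K0 i"
    by (rule exists_steiner_centered[OF inv, of K I]) (simp_all add: K)
  then have K0: "?Q K0" by blast
  \<comment> \<open>The origin stays in the bodies, as it is its own projection.\<close>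
  have "steiner_invariant (\<lambda>L::'i \<Rightarrow> 'a set. \<forall>i\<in>I. 0 \<in> L i)"
    unfolding steiner_invariant_def using projection_in_steiner[of _ 0] by auto
  then have Q: "steiner_invariant ?Q" by (intro steiner_invariant_conj inv)
  \<comment> \<open>All radii are served by one tolerance; the factor one half makes the comparison strict, and the
      element \<open>1\<close> covers the case that all radii are zero.\<close>
  define \<eta> where "\<eta> = Min (insert 1 ((\<lambda>i. measure lborel (cball (0::'a) (e * r i / 2)) / 2) ` {i\<in>I. 0 < r i}))"
  have fin: "finite (insert 1 ((\<lambda>i. measure lborel (cball (0::'a) (e * r i / 2)) / 2) ` {i\<in>I. 0 < r i}))"
    using I by simp
  have \<eta>0: "0 < \<eta>" unfolding \<eta>_def using fin e by (subst Min_gr_iff) (auto simp: content_cball)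
  have \<eta>: "\<eta> < measure lborel (cball (0::'a) (e * r i / 2))" if "i \<in> I" "0 < r i" for i
  proof -
    have "\<eta> \<le> measure lborel (cball (0::'a) (e * r i / 2)) / 2"
      unfolding \<eta>_def using that by (intro Min_le[OF fin]) auto
    moreover have "0 < measure lborel (cball (0::'a) (e * r i / 2))" using e that by (simp add: content_cball)
    ultimately show ?thesis by linarith
  qed
  define d where "d = \<eta>\<^sup>2 / (measure lborel (cball (0::'a) (2 * R)) + 1)"
  have d: "0 < d" using \<eta>0 by (simp add: d_def add_nonneg_pos)
  define \<Phi> where "\<Phi> L = (\<Sum>i\<in>I. measure lborel (L i \<inter> cball 0 (r i)))" for L :: "'i \<Rightarrow> 'a set"
  have \<Phi>_le: "\<Phi> L \<le> (\<Sum>i\<in>I. measure lborel (cball (0::'a) (r i)))" if "?Q L" for L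
    unfolding \<Phi>_def using that
    by (intro sum_mono measure_mono_fmeasurable) (auto simp: borel_compact fmeasurable_compact)
  have "\<exists>L. ?Q L \<and> (\<forall>i\<in>I. measure lborel (cball 0 (r i) - L i) < \<eta>)"
  proof (rule ccontr)
    assume neg: "\<not> (\<exists>L. ?Q L \<and> (\<forall>i\<in>I. measure lborel (cball 0 (r i) - L i) < \<eta>))"
    have step: "\<exists>L'. ?Q L' \<and> \<Phi> L + d \<le> \<Phi> L'" if L: "?Q L" for L
    proof -
      obtain i where i: "i \<in> I" "\<eta> \<le> measure lborel (cball 0 (r i) - L i)"
        using neg L by (meson not_le)
      obtain u where u: "norm u = 1" "measure lborel (L i \<inter> cball 0 (r i)) + d
          \<le> measure lborel (steiner u (L i) \<inter> cball 0 (r i))"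
        unfolding d_def
        using steiner_volume_gain[of "L i" "r i" R \<eta>] L i r rR \<eta>0 by metis
      have "\<Phi> L + d = (\<Sum>j\<in>I. measure lborel (L j \<inter> cball 0 (r j)) + (if j = i then d else 0))"
        unfolding \<Phi>_def sum.distrib using i I by simp
      also have "\<dots> \<le> (\<Sum>j\<in>I. measure lborel (steiner u (L j) \<inter> cball 0 (r j)))"
        using u L r by (intro sum_mono) (auto simp: steiner_Int_cball_mono)
      finally have "\<Phi> L + d \<le> \<Phi> (\<lambda>i. steiner u (L i))" by (simp add: \<Phi>_def)
      moreover have "?Q (\<lambda>i. steiner u (L i))"
        by (rule steiner_invariantD[of ?Q, OF Q u(1) L])
      ultimately show ?thesis by blast
    qed
    have "\<exists>L. ?Q L \<and> real k * d \<le> \<Phi> L" for k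
    proof (induction k)
      case 0
      have "0 \<le> \<Phi> K0" unfolding \<Phi>_def by (intro sum_nonneg) auto
      then show ?case using K0 by auto
    next
      case (Suc k)
      then obtain L where L: "?Q L" "real k * d \<le> \<Phi> L" by blast
      obtain L' where L': "?Q L'" "\<Phi> L + d \<le> \<Phi> L'" using step[OF L(1)] by blast
      have "real (Suc k) * d \<le> \<Phi> L'" using L L' by (simp add: algebra_simps)
      with L'(1) show ?case by blast
    qed
    then have "real k * d \<le> (\<Sum>i\<in>I. measure lborel (cball (0::'a) (r i)))" for k
      using \<Phi>_le by (meson order_trans)
    then show False using reals_Archimedean3[OF d] by (meson not_le)
  qed
  then obtain L where L: "?Q L" "\<And>i. i \<in> I \<Longrightarrow> measure lborel (cball 0 (r i) - L i) < \<eta>" by blast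
  have "cball 0 ((1 - e) * r i) \<subseteq> L i" if i: "i \<in> I" for i
    using convex_superset_cball[of "L i" "r i" e] L(1) L(2)[OF i] \<eta>[OF i] r[OF i] e i by force
  then show thesis using that L(1) by blast
qed

section \<open>Sublevel sets of inner linearizations\<close>

lemma convex_hull_image_finite:
  fixes f :: "'i \<Rightarrow> 'b::real_vector"
  assumes I: "finite I"
  shows "convex hull (f ` I) = {\<Sum>i\<in>I. w i *\<^sub>R f i | w. (\<forall>i\<in>I. 0 \<le> w i) \<and> sum w I = 1}" (is "_ = ?T")
proof
  show "convex hull (f ` I) \<subseteq> ?T"
  proof (rule hull_minimal)
    show "f ` I \<subseteq> ?T"
    proof
      fix z assume "z \<in> f ` I"
      then obtain j where j: "j \<in> I" "z = f j" by auto
      have "(\<Sum>i\<in>I. (if i = j then 1 else 0) *\<^sub>R f i) = (\<Sum>i\<in>I. if i = j then f i else 0)"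
        by (intro sum.cong) auto
      then have "z = (\<Sum>i\<in>I. (if i = j then 1 else 0) *\<^sub>R f i)" using j I by simp
      moreover have "\<forall>i\<in>I. (0::real) \<le> (if i = j then 1 else 0)" "(\<Sum>i\<in>I. if i = j then 1 else 0) = (1::real)"
        using j I by auto
      ultimately show "z \<in> ?T"
        by (intro CollectI exI[of _ "\<lambda>i. if i = j then 1 else 0"] conjI)
    qed
    show "convex ?T"
    proof (rule convexI)
      fix a b and u v :: real assume "a \<in> ?T" "b \<in> ?T" and uv: "0 \<le> u" "0 \<le> v" "u + v = 1"
      then obtain w w' where w: "a = (\<Sum>i\<in>I. w i *\<^sub>R f i)" "\<forall>i\<in>I. 0 \<le> w i" "sum w I = 1"
        and w': "b = (\<Sum>i\<in>I. w' i *\<^sub>R f i)" "\<forall>i\<in>I. 0 \<le> w' i" "sum w' I = 1" by blast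
      have "u *\<^sub>R a + v *\<^sub>R b = (\<Sum>i\<in>I. (u * w i + v * w' i) *\<^sub>R f i)"
        by (simp add: w(1) w'(1) scaleR_sum_right scaleR_add_left sum.distrib)
      moreover have "\<forall>i\<in>I. 0 \<le> u * w i + v * w' i" using w(2) w'(2) uv by simp
      moreover have "(\<Sum>i\<in>I. u * w i + v * w' i) = 1"
        using w(3) w'(3) uv by (simp add: sum.distrib flip: sum_distrib_left)
      ultimately show "u *\<^sub>R a + v *\<^sub>R b \<in> ?T"
        by (intro CollectI exI[of _ "\<lambda>i. u * w i + v * w' i"] conjI)
    qed
  qed
  show "?T \<subseteq> convex hull (f ` I)"
    using convex_sum[OF I convex_convex_hull, of _ f "f ` I"] by (auto simp: hull_inc)
qed

text \<open>The sublevel set at height \<open>s\<close> of the inner linearization of the points \<open>(x i, y i)\<close>.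
  The points are indexed, so that they can be moved, and may collide, while the weights and the
  heights \<open>y\<close> stay the same.\<close>

definition sublevel :: "'i set \<Rightarrow> ('i \<Rightarrow> 'a::euclidean_space) \<Rightarrow> ('i \<Rightarrow> real) \<Rightarrow> real \<Rightarrow> 'a set" where
  "sublevel I x y s = {\<Sum>i\<in>I. w i *\<^sub>R x i | w.
     (\<forall>i\<in>I. 0 \<le> w i) \<and> sum w I = 1 \<and> (\<Sum>i\<in>I. w i * y i) \<le> s}"

lemma sublevel_eq_hull:
  assumes "finite I"
  shows "sublevel I x y s = {z. \<exists>t\<le>s. (z, t) \<in> convex hull ((\<lambda>i. (x i, y i)) ` I)}"
proof -
  have eq: "(\<Sum>i\<in>I. w i *\<^sub>R (x i, y i)) = (\<Sum>i\<in>I. w i *\<^sub>R x i, \<Sum>i\<in>I. w i * y i)" for w :: "'a \<Rightarrow> real"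
    by (simp add: prod_eq_iff fst_sum snd_sum)
  show ?thesis unfolding sublevel_def convex_hull_image_finite[OF assms] eq by auto
qed

lemma sublevel_eq_image:
  assumes "finite I"
  shows "sublevel I x y s = fst ` (convex hull ((\<lambda>i. (x i, y i)) ` I) \<inter> {p. snd p \<le> s})"
  unfolding sublevel_eq_hull[OF assms] by force

lemma compact_sublevel: "finite I \<Longrightarrow> compact (sublevel I x y s)"
  unfolding sublevel_eq_image
  by (intro compact_continuous_image compact_Int_closed closed_Collect_le continuous_intros
      finite_imp_compact_convex_hull finite_imageI)

lemma convex_sublevel: assumes "finite I" shows "convex (sublevel I x y s)"
  unfolding sublevel_eq_image[OF assms]
proof (intro convex_linear_image linear_fst convex_Int convex_convex_hull)
  have "{p::'b \<times> real. snd p \<le> s} = snd -` {..s}" by auto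
  then show "convex {p::'b \<times> real. snd p \<le> s}"
    by (simp add: convex_linear_vimage linear_snd)
qed

text \<open>The convexity of volume along parallel movements of the vertices. All three systems
  of vertices have the same projections \<open>p\<close>, so a line parallel to \<open>u\<close> singles out the same weights
  \<open>w\<close> for each of them; on the line a weight gives the three positions \<open>\<Sum> w a\<close>, \<open>\<Sum> w b\<close> and half
  their difference. Hence the chord of the middle body lies in \<open>(I - J) / 2\<close>, where \<open>I\<close> and \<open>J\<close> are the
  chords of the other two, and the length of \<open>(I - J) / 2\<close> is the mean of their lengths. Taking the
  difference instead of the sum incorporates the reflection in the hyperplane orthogonal to \<open>u\<close>.\<close>

lemma sublevel_steiner:
  fixes p :: "'i \<Rightarrow> 'a::euclidean_space" and a b y :: "'i \<Rightarrow> real"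
  assumes I: "finite I" and u: "norm u = 1" and p: "\<And>i. i \<in> I \<Longrightarrow> p i \<bullet> u = 0"
  shows "2 * emeasure lborel (sublevel I (\<lambda>i. p i + ((a i - b i) / 2) *\<^sub>R u) y s) \<le>
    emeasure lborel (sublevel I (\<lambda>i. p i + a i *\<^sub>R u) y s) +
    emeasure lborel (sublevel I (\<lambda>i. p i + b i *\<^sub>R u) y s)"
proof -
  let ?S = "\<lambda>c. sublevel I (\<lambda>i. p i + c i *\<^sub>R u) y s"
  let ?m = "\<lambda>i. (a i - b i) / 2"
  have uu: "u \<bullet> u = 1" using u by (simp add: dot_square_norm)
  have [measurable]: "?S c \<in> sets borel" for c
    by (rule borel_compact[OF compact_sublevel[OF I]])
  have comb: "(\<Sum>i\<in>I. w i *\<^sub>R (p i + c i *\<^sub>R u)) = (\<Sum>i\<in>I. w i *\<^sub>R p i) + (\<Sum>i\<in>I. w i * c i) *\<^sub>R u" for w c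
    by (simp add: scaleR_add_right sum.distrib scaleR_sum_left)
  have "(\<integral>\<^sup>+z. 2 * indicator (?S ?m) z \<partial>lborel) \<le> (\<integral>\<^sup>+z. indicator (?S a) z + indicator (?S b) z \<partial>lborel)"
  proof (rule nn_integral_mono_lines[OF _ _ u])
    fix z :: 'a assume z: "z \<bullet> u = 0"
    let ?T = "\<lambda>c. {t. z + t *\<^sub>R u \<in> ?S c}"
    have sub: "\<exists>\<alpha>\<in>?T a. \<exists>\<beta>\<in>?T b. t = (\<alpha> - \<beta>) / 2" if t: "t \<in> ?T ?m" for t
    proof -
      obtain w where w: "z + t *\<^sub>R u = (\<Sum>i\<in>I. w i *\<^sub>R p i) + (\<Sum>i\<in>I. w i * ?m i) *\<^sub>R u"
        "\<forall>i\<in>I. 0 \<le> w i" "sum w I = 1" "(\<Sum>i\<in>I. w i * y i) \<le> s"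
        using t unfolding sublevel_def comb by blast
      have wp: "(\<Sum>i\<in>I. w i *\<^sub>R p i) \<bullet> u = 0" by (simp add: inner_sum_left p)
      have "(z + t *\<^sub>R u) \<bullet> u = ((\<Sum>i\<in>I. w i *\<^sub>R p i) + (\<Sum>i\<in>I. w i * ?m i) *\<^sub>R u) \<bullet> u"
        using w(1) by (simp only:)
      then have t: "t = (\<Sum>i\<in>I. w i * ?m i)"
        unfolding inner_add_left inner_scaleR_left uu z wp by simp
      with w(1) have zp: "z = (\<Sum>i\<in>I. w i *\<^sub>R p i)" by simp
      have "(\<Sum>i\<in>I. w i * c i) \<in> ?T c" for c
        unfolding sublevel_def comb zp using w(2-4) by blast
      moreover have "t = ((\<Sum>i\<in>I. w i * a i) - (\<Sum>i\<in>I. w i * b i)) / 2"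
        unfolding t by (simp add: sum_subtractf[symmetric] sum_divide_distrib right_diff_distrib)
      ultimately show ?thesis by blast
    qed
    have len: "2 * emeasure lborel (?T ?m) \<le> emeasure lborel (?T a) + emeasure lborel (?T b)"
    proof (cases "?T ?m = {}")
      case True then show ?thesis by (simp only: emeasure_empty) simp
    next
      case False
      have ne: "?T a \<noteq> {}" "?T b \<noteq> {}" using False sub by blast+
      obtain \<alpha> \<alpha>' where a: "\<alpha> \<le> \<alpha>'" "?T a = {\<alpha>..\<alpha>'}"
        by (rule line_slice_nonempty[OF u compact_sublevel[OF I] convex_sublevel[OF I] ne(1)])
      obtain \<beta> \<beta>' where b: "\<beta> \<le> \<beta>'" "?T b = {\<beta>..\<beta>'}"
        by (rule line_slice_nonempty[OF u compact_sublevel[OF I] convex_sublevel[OF I] ne(2)])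
      have "?T ?m \<subseteq> {(\<alpha> - \<beta>') / 2 .. (\<alpha>' - \<beta>) / 2}"
        using sub unfolding a b by fastforce
      then have "emeasure lborel (?T ?m) \<le> ennreal ((\<alpha>' - \<beta>) / 2 - (\<alpha> - \<beta>') / 2)"
        using emeasure_mono[of "?T ?m" "{(\<alpha> - \<beta>') / 2 .. (\<alpha>' - \<beta>) / 2}" lborel] a(1) b(1) by simp
      then have "2 * emeasure lborel (?T ?m) \<le> 2 * ennreal ((\<alpha>' - \<beta>) / 2 - (\<alpha> - \<beta>') / 2)"
        by (rule mult_left_mono) simp
      also have "\<dots> = ennreal (2 * ((\<alpha>' - \<beta>) / 2 - (\<alpha> - \<beta>') / 2))"
        using a(1) b(1) by (subst ennreal_mult) simp_all
      also have "\<dots> = ennreal ((\<alpha>' - \<alpha>) + (\<beta>' - \<beta>))"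
        by (rule arg_cong[where f = ennreal]) (simp add: field_simps)
      also have "\<dots> = emeasure lborel (?T a) + emeasure lborel (?T b)"
        unfolding a b using a(1) b(1) by simp
      finally show ?thesis .
    qed
    have "(\<integral>\<^sup>+t. 2 * indicator (?S ?m) (z + t *\<^sub>R u) \<partial>lborel) = 2 * emeasure lborel (?T ?m)"
      by (subst nn_integral_cmult) (simp_all add: nn_integral_indicator_line)
    moreover have "(\<integral>\<^sup>+t. indicator (?S a) (z + t *\<^sub>R u) + indicator (?S b) (z + t *\<^sub>R u) \<partial>lborel)
        = emeasure lborel (?T a) + emeasure lborel (?T b)"
      by (subst nn_integral_add) (simp_all add: nn_integral_indicator_line)
    ultimately show "(\<integral>\<^sup>+t. 2 * indicator (?S ?m) (z + t *\<^sub>R u) \<partial>lborel) \<le>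
      (\<integral>\<^sup>+t. indicator (?S a) (z + t *\<^sub>R u) + indicator (?S b) (z + t *\<^sub>R u) \<partial>lborel)"
      using len by simp
  qed simp_all
  then show ?thesis
    by (simp add: nn_integral_cmult nn_integral_add)
qed

section \<open>The mass of an inner log-linearization\<close>

lemma inner_lin_le_iff:
  assumes X: "finite X"
  shows "inner_lin X z \<le> ereal s \<longleftrightarrow> (\<exists>t\<le>s. (z, t) \<in> convex hull X)"
proof
  assume *: "inner_lin X z \<le> ereal s"
  then have z: "z \<in> convex hull (fst ` X)" by (auto simp: inner_lin_def split: if_splits)
  from inner_lin_attained[OF X z] * z show "\<exists>t\<le>s. (z, t) \<in> convex hull X"
    by (auto simp: inner_lin_def comb_values_eq[OF X])
next
  assume "\<exists>t\<le>s. (z, t) \<in> convex hull X"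
  then obtain t where t: "t \<le> s" "(z, t) \<in> convex hull X" by blast
  then have "z \<in> fst ` (convex hull X)" by force
  then have z: "z \<in> convex hull (fst ` X)" by (simp add: convex_hull_linear_image linear_fst)
  from inner_lin_attained[OF X z] t have "Inf (comb_values X z) \<le> s"
    by (auto simp: comb_values_eq[OF X])
  with z show "inner_lin X z \<le> ereal s" by (simp add: inner_lin_def)
qed

lemma inner_lin_not_minus_infinity: "inner_lin X z \<noteq> -\<infinity>"
  by (simp add: inner_lin_def)

lemma inner_lin_sublevel:
  assumes "finite I"
  shows "{z. inner_lin ((\<lambda>i. (x i, y i)) ` I) z \<le> ereal s} = sublevel I x y s"
  using assms by (simp add: inner_lin_le_iff sublevel_eq_hull)

text \<open>Superlevel sets of \<open>exp_neg p\<close> are sublevel sets of \<open>p\<close>; all integrals below are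
  computed through them.\<close>

lemma exp_neg_ge_iff:
  assumes "p z \<noteq> -\<infinity>" "0 < t"
  shows "t \<le> exp_neg p z \<longleftrightarrow> p z \<le> ereal (- ln t)"
proof (cases "p z")
  case (real a)
  have "t \<le> exp (- a) \<longleftrightarrow> ln t \<le> - a" using assms(2) by (metis exp_gt_zero ln_exp ln_le_cancel_iff)
  then show ?thesis using real by (simp add: exp_neg_def le_minus_iff)
qed (use assms in \<open>auto simp: exp_neg_def\<close>)

lemma exp_neg_nonneg: "0 \<le> exp_neg p z"
  by (simp add: exp_neg_def)

lemma borel_measurable_exp_neg:
  assumes p: "\<And>z. p z \<noteq> -\<infinity>" and cl: "\<And>s. closed {z. p z \<le> ereal s}"
  shows "exp_neg p \<in> borel_measurable borel"
proof (subst borel_measurable_iff_ge, rule allI)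
  fix t :: real
  show "{z \<in> space borel. t \<le> exp_neg p z} \<in> sets borel"
  proof (cases "0 < t")
    case True
    then show ?thesis using cl by (simp add: exp_neg_ge_iff p borel_closed)
  next
    case False
    then have "t \<le> exp_neg p z" for z using exp_neg_nonneg[of p z] by linarith
    then show ?thesis by simp
  qed
qed

lemma layer_cake:
  fixes g :: "'a::euclidean_space \<Rightarrow> real"
  assumes [measurable]: "g \<in> borel_measurable borel" and nonneg: "\<And>z. 0 \<le> g z"
  shows "(\<integral>\<^sup>+z. g z \<partial>lborel) = (\<integral>\<^sup>+t. indicator {0<..} t * emeasure lborel {z. t \<le> g z} \<partial>lborel)"
    and "(\<lambda>t. indicator {0<..} t * emeasure lborel {z. t \<le> g z}) \<in> borel_measurable borel"
proof -
  have eq: "(\<integral>\<^sup>+z. indicator {0<..g z} t \<partial>lborel) = indicator {0<..} t * emeasure lborel {z. t \<le> g z}" for t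
  proof -
    have "(\<integral>\<^sup>+z. indicator {0<..g z} t \<partial>lborel) = (\<integral>\<^sup>+z. indicator {0<..} t * indicator {z. t \<le> g z} z \<partial>lborel)"
      by (intro nn_integral_cong) (auto simp: indicator_def)
    also have "\<dots> = indicator {0<..} t * emeasure lborel {z. t \<le> g z}"
      by (subst nn_integral_cmult) auto
    finally show ?thesis .
  qed
  have "(\<integral>\<^sup>+z. g z \<partial>lborel) = (\<integral>\<^sup>+z. (\<integral>\<^sup>+t. indicator {0<..g z} t \<partial>lborel) \<partial>lborel)"
    using nonneg by (intro nn_integral_cong) simp
  also have "\<dots> = (\<integral>\<^sup>+t. (\<integral>\<^sup>+z. indicator {0<..g z} t \<partial>lborel) \<partial>lborel)"
    by (rule lborel_pair.Fubini'[symmetric]) (simp add: indicator_def)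
  finally show "(\<integral>\<^sup>+z. g z \<partial>lborel) = (\<integral>\<^sup>+t. indicator {0<..} t * emeasure lborel {z. t \<le> g z} \<partial>lborel)"
    by (simp only: eq)
  have "(\<lambda>t. \<integral>\<^sup>+z. indicator {0<..g z} t \<partial>lborel) \<in> borel_measurable borel"
    by (intro lborel.borel_measurable_nn_integral) (simp add: indicator_def)
  then show "(\<lambda>t. indicator {0<..} t * emeasure lborel {z. t \<le> g z}) \<in> borel_measurable borel"
    by (simp only: eq)
qed

text \<open>Masses are compared as extended nonnegative numbers. A divergent integral
  has total mass zero, the value of \<open>enn2real\<close> at infinity.\<close>

lemma total_mass_eq_nn_integral:
  assumes [measurable]: "g \<in> borel_measurable borel" and nonneg: "\<And>z. 0 \<le> g z"
  shows "total_mass g = enn2real (\<integral>\<^sup>+z. g z \<partial>lborel)"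
  unfolding total_mass_def using nonneg
  by (subst integral_completion) (auto intro!: integral_eq_nn_integral)

definition hull_mass :: "'i set \<Rightarrow> ('i \<Rightarrow> real^'n) \<Rightarrow> ('i \<Rightarrow> real) \<Rightarrow> ennreal" where
  "hull_mass I x y = (\<integral>\<^sup>+z. exp_neg (inner_lin ((\<lambda>i. (x i, y i)) ` I)) z \<partial>lborel)"

lemma borel_measurable_inner_lin:
  assumes "finite X" shows "exp_neg (inner_lin X) \<in> borel_measurable borel"
proof (rule borel_measurable_exp_neg[OF inner_lin_not_minus_infinity])
  fix s show "closed {z. inner_lin X z \<le> ereal s}"
    using inner_lin_sublevel[OF assms, of fst snd s] compact_sublevel[OF assms, of fst snd s]
    by (simp add: compact_imp_closed)
qed

lemma hull_mass_levels:
  fixes x :: "'i \<Rightarrow> real^'n"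
  assumes I: "finite I"
  shows "hull_mass I x y = (\<integral>\<^sup>+t. indicator {0<..} t * emeasure lborel (sublevel I x y (- ln t)) \<partial>lborel)"
    and "(\<lambda>t. indicator {0<..} t * emeasure lborel (sublevel I x y (- ln t))) \<in> borel_measurable borel"
proof -
  let ?g = "exp_neg (inner_lin ((\<lambda>i. (x i, y i)) ` I))"
  have eq: "indicator {0<..} t * emeasure lborel {z. t \<le> ?g z} =
      indicator {0<..} t * emeasure lborel (sublevel I x y (- ln t))" for t
    by (cases "0 < t")
      (simp_all add: exp_neg_ge_iff inner_lin_not_minus_infinity inner_lin_sublevel[OF I])
  show "hull_mass I x y = (\<integral>\<^sup>+t. indicator {0<..} t * emeasure lborel (sublevel I x y (- ln t)) \<partial>lborel)"
    and "(\<lambda>t. indicator {0<..} t * emeasure lborel (sublevel I x y (- ln t))) \<in> borel_measurable borel"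
    using layer_cake[OF borel_measurable_inner_lin exp_neg_nonneg, of "(\<lambda>i. (x i, y i)) ` I"] I
    unfolding eq hull_mass_def by simp_all
qed

lemma hull_mass_cong:
  "(\<And>i. i \<in> I \<Longrightarrow> x i = x' i) \<Longrightarrow> hull_mass I x y = hull_mass I x' y"
  unfolding hull_mass_def by (simp cong: image_cong)

text \<open>Integrating the inequality for sublevel sets over all heights, twice the mass of the
  symmetrized vertex system is at most the sum of the masses of the two systems from which it is
  formed. So one of the two has at least the same mass.\<close>

lemma hull_mass_steiner:
  fixes p :: "'i \<Rightarrow> real^'n"
  assumes I: "finite I" and u: "norm u = 1" and p: "\<And>i. i \<in> I \<Longrightarrow> p i \<bullet> u = 0"
  shows "hull_mass I (\<lambda>i. p i + ((a i - b i) / 2) *\<^sub>R u) y \<le> hull_mass I (\<lambda>i. p i + a i *\<^sub>R u) y \<or>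
    hull_mass I (\<lambda>i. p i + ((a i - b i) / 2) *\<^sub>R u) y \<le> hull_mass I (\<lambda>i. p i + b i *\<^sub>R u) y"
proof -
  let ?W = "\<lambda>c. hull_mass I (\<lambda>i. p i + c i *\<^sub>R u) y"
  let ?h = "\<lambda>c t. indicator {0<..} t * emeasure lborel (sublevel I (\<lambda>i. p i + c i *\<^sub>R u) y (- ln t))"
  let ?m = "\<lambda>i. (a i - b i) / 2"
  note [measurable] = hull_mass_levels(2)[OF I]
  have "2 * ?W ?m = (\<integral>\<^sup>+t. 2 * ?h ?m t \<partial>lborel)"
    unfolding hull_mass_levels(1)[OF I] by (subst nn_integral_cmult) simp_all
  also have "\<dots> \<le> (\<integral>\<^sup>+t. ?h a t + ?h b t \<partial>lborel)"
  proof (rule nn_integral_mono)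
    fix t show "2 * ?h ?m t \<le> ?h a t + ?h b t"
      using sublevel_steiner[OF I u p, where a = a and b = b and y = y and s = "- ln t"]
      by (cases "0 < t") simp_all
  qed
  also have "\<dots> = ?W a + ?W b"
    unfolding hull_mass_levels(1)[OF I] by (rule nn_integral_add) simp_all
  finally have le: "2 * ?W ?m \<le> ?W a + ?W b" .
  show ?thesis
  proof (cases "?W a \<le> ?W b")
    case True
    then have "?W a + ?W b \<le> 2 * ?W b" by (simp add: mult_2 add_right_mono)
    with le have "2 * ?W ?m \<le> 2 * ?W b" by (rule order_trans)
    then show ?thesis by (simp add: ennreal_mult_le_mult_iff)
  next
    case False
    then have "?W b \<le> ?W a" by simp
    then have "?W a + ?W b \<le> 2 * ?W a" by (simp add: mult_2 add_left_mono)
    with le have "2 * ?W ?m \<le> 2 * ?W a" by (rule order_trans)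
    then show ?thesis by (simp add: ennreal_mult_le_mult_iff)
  qed
qed

text \<open>Scaling the vertices compensates for the fact that the symmetrized bodies contain only
  slightly shrunk balls.\<close>

lemma hull_mass_scale:
  fixes x :: "'i \<Rightarrow> real^'n"
  assumes I: "finite I" and c: "0 < c"
  shows "hull_mass I (\<lambda>i. c *\<^sub>R x i) y = ennreal (c ^ CARD('n)) * hull_mass I x y"
proof -
  have eq: "emeasure lborel (sublevel I (\<lambda>i. c *\<^sub>R x i) y s) =
      ennreal (c ^ CARD('n)) * emeasure lborel (sublevel I x y s)" for s
  proof -
    have "sublevel I (\<lambda>i. c *\<^sub>R x i) y s = (\<lambda>z. c *\<^sub>R z + 0) ` sublevel I x y s"
    proof -
      have scale: "(\<Sum>i\<in>I. w i *\<^sub>R c *\<^sub>R x i) = c *\<^sub>R (\<Sum>i\<in>I. w i *\<^sub>R x i)" for w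
        by (simp add: scaleR_sum_right mult.commute)
      show ?thesis unfolding sublevel_def setcompr_eq_image image_image by (simp only: scale add_0_right)
    qed
    moreover have "emeasure lebesgue ((\<lambda>z. c *\<^sub>R z + 0) ` sublevel I x y s)
        = ennreal (c ^ CARD('n)) * emeasure lebesgue (sublevel I x y s)"
      using emeasure_lebesgue_affine[of c 0 "sublevel I x y s"] c by simp
    moreover have "sublevel I x y s \<in> sets borel" "sublevel I (\<lambda>i. c *\<^sub>R x i) y s \<in> sets borel"
      by (rule borel_compact[OF compact_sublevel[OF I]])+
    ultimately show ?thesis by (simp add: emeasure_completion)
  qed
  note [measurable] = hull_mass_levels(2)[OF I]
  show ?thesis
    unfolding hull_mass_levels(1)[OF I] eq
    by (subst nn_integral_cmult[symmetric]) (simp_all add: ac_simps)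
qed

text \<open>The functional analogue of the theorem that, among bodies of given volume, balls are
  worst approximated by inscribed polytopes. The bodies \<open>L i\<close> are the sublevel sets in which the
  vertices may move, and the \<open>x i\<close> lie in the balls of the same volumes. Consider the property of a
  family \<open>K\<close> that every choice of vertices in \<open>K\<close> is matched in mass by a choice in \<open>L\<close>. It holds
  trivially for \<open>L\<close> and it survives Steiner symmetrization, because a vertex of a symmetral comes
  from two points of \<open>K i\<close> on a line parallel to \<open>u\<close>. Hence it reaches bodies that contain the
  shrunk points \<open>(1 - e) x i\<close>.\<close>

lemma exists_hull_mass_ge_balls:
  fixes x :: "'i \<Rightarrow> real^'n" and L :: "'i \<Rightarrow> (real^'n) set"
  assumes I: "finite I"
    and L: "\<And>i. i \<in> I \<Longrightarrow> compact (L i) \<and> convex (L i) \<and> L i \<noteq> {}"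
    and r: "\<And>i. i \<in> I \<Longrightarrow> 0 \<le> r i \<and> measure lborel (cball (0::real^'n) (r i)) = measure lborel (L i)"
    and x: "\<And>i. i \<in> I \<Longrightarrow> norm (x i) \<le> r i"
    and e: "0 < e" "e < 1"
  obtains z where "\<And>i. i \<in> I \<Longrightarrow> z i \<in> L i"
    "ennreal ((1 - e) ^ CARD('n)) * hull_mass I x y \<le> hull_mass I z y"
proof -
  let ?P = "\<lambda>K :: 'i \<Rightarrow> (real^'n) set. \<forall>w. (\<forall>i\<in>I. w i \<in> K i) \<longrightarrow> (\<exists>z. (\<forall>i\<in>I. z i \<in> L i) \<and> hull_mass I w y \<le> hull_mass I z y)"
  have inv: "steiner_invariant ?P"
    unfolding steiner_invariant_def
  proof (intro allI impI)
    fix K :: "'i \<Rightarrow> (real^'n) set" and u w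
    assume u: "norm u = 1" and P: "?P K" and w: "\<forall>i\<in>I. w i \<in> steiner u (K i)"
    have "\<forall>i\<in>I. \<exists>q. w i = fst q + ((fst (snd q) - snd (snd q)) / 2) *\<^sub>R u \<and> fst q \<bullet> u = 0 \<and>
        fst q + fst (snd q) *\<^sub>R u \<in> K i \<and> fst q + snd (snd q) *\<^sub>R u \<in> K i"
    proof
      fix i assume "i \<in> I"
      with w obtain p s s' where "w i = p + ((s - s') / 2) *\<^sub>R u" "p \<bullet> u = 0"
        "p + s *\<^sub>R u \<in> K i" "p + s' *\<^sub>R u \<in> K i"
        unfolding steiner_def by blast
      then show "\<exists>q. w i = fst q + ((fst (snd q) - snd (snd q)) / 2) *\<^sub>R u \<and> fst q \<bullet> u = 0 \<and>
        fst q + fst (snd q) *\<^sub>R u \<in> K i \<and> fst q + snd (snd q) *\<^sub>R u \<in> K i"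
        by (intro exI[of _ "(p, s, s')"]) simp
    qed
    then obtain q where q: "\<forall>i\<in>I. w i = fst (q i) + ((fst (snd (q i)) - snd (snd (q i))) / 2) *\<^sub>R u \<and>
        fst (q i) \<bullet> u = 0 \<and> fst (q i) + fst (snd (q i)) *\<^sub>R u \<in> K i \<and>
        fst (q i) + snd (snd (q i)) *\<^sub>R u \<in> K i"
      by (rule bchoice[THEN exE])
    define p where "p i = fst (q i)" for i
    define a where "a i = fst (snd (q i))" for i
    define b where "b i = snd (snd (q i))" for i
    have pab: "w i = p i + ((a i - b i) / 2) *\<^sub>R u" "p i \<bullet> u = 0"
      "p i + a i *\<^sub>R u \<in> K i" "p i + b i *\<^sub>R u \<in> K i" if "i \<in> I" for i
      using q that unfolding p_def a_def b_def by blast+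
    have "hull_mass I w y = hull_mass I (\<lambda>i. p i + ((a i - b i) / 2) *\<^sub>R u) y"
      by (rule hull_mass_cong) (rule pab(1))
    then have "hull_mass I w y \<le> hull_mass I (\<lambda>i. p i + a i *\<^sub>R u) y \<or>
        hull_mass I w y \<le> hull_mass I (\<lambda>i. p i + b i *\<^sub>R u) y"
      using hull_mass_steiner[OF I u pab(2), where a = a and b = b and y = y] by simp
    moreover have "\<exists>z. (\<forall>i\<in>I. z i \<in> L i) \<and> hull_mass I (\<lambda>i. p i + a i *\<^sub>R u) y \<le> hull_mass I z y"
      using P[rule_format, of "\<lambda>i. p i + a i *\<^sub>R u"] pab(3) by blast
    moreover have "\<exists>z. (\<forall>i\<in>I. z i \<in> L i) \<and> hull_mass I (\<lambda>i. p i + b i *\<^sub>R u) y \<le> hull_mass I z y"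
      using P[rule_format, of "\<lambda>i. p i + b i *\<^sub>R u"] pab(4) by blast
    ultimately show "\<exists>z. (\<forall>i\<in>I. z i \<in> L i) \<and> hull_mass I w y \<le> hull_mass I z y"
      by (meson order_trans)
  qed
  have "?P L" by blast
  then obtain K where K: "?P K" "\<And>i. i \<in> I \<Longrightarrow> cball 0 ((1 - e) * r i) \<subseteq> K i"
    by (rule exists_steiner_nearly_round[OF I inv, of L r e]) (use L r e in auto)
  have "(1 - e) *\<^sub>R x i \<in> K i" if i: "i \<in> I" for i
    using K(2)[OF i] x[OF i] e by (auto simp: subset_iff mult_left_mono)
  then obtain z where "\<forall>i\<in>I. z i \<in> L i" "hull_mass I (\<lambda>i. (1 - e) *\<^sub>R x i) y \<le> hull_mass I z y"
    using K(1)[rule_format, of "\<lambda>i. (1 - e) *\<^sub>R x i"] by blast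
  then show thesis using e by (intro that[of z]) (simp_all add: hull_mass_scale[OF I])
qed

section \<open>Volume radius and the Brunn-Minkowski inequality\<close>

lemma measure_cball_power:
  assumes "0 \<le> r"
  shows "measure lebesgue (cball (0::real^'n) r) = measure lebesgue (cball (0::real^'n) 1) * r ^ CARD('n)"
    and "0 < measure lebesgue (cball (0::real^'n) 1)"
  using assms by (simp_all add: content_cball)

definition vol_radius :: "(real^'n) set \<Rightarrow> real" where
  "vol_radius A = (THE r. 0 \<le> r \<and> measure lebesgue (cball 0 r :: (real^'n) set) = measure lebesgue A)"

lemma measure_cball_le_iff:
  assumes "0 \<le> a" "0 \<le> b"
  shows "measure lebesgue (cball (0::real^'n) a) \<le> measure lebesgue (cball (0::real^'n) b) \<longleftrightarrow> a \<le> b"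
  using assms measure_cball_power(2)[of 0, where 'n = 'n]
  by (simp add: measure_cball_power(1)[OF assms(1)] measure_cball_power(1)[OF assms(2)])

lemma vol_radius:
  fixes A :: "(real^'n) set"
  shows "0 \<le> vol_radius A" "measure lebesgue (cball (0::real^'n) (vol_radius A)) = measure lebesgue A"
proof -
  let ?Q = "\<lambda>r. 0 \<le> r \<and> measure lebesgue (cball 0 r :: (real^'n) set) = measure lebesgue A"
  let ?c = "measure lebesgue (cball (0::real^'n) 1)"
  have c: "0 < ?c" by (rule measure_cball_power(2)[of 0]) simp
  define \<rho> where "\<rho> = root CARD('n) (measure lebesgue A / ?c)"
  have \<rho>: "0 \<le> \<rho>" "\<rho> ^ CARD('n) = measure lebesgue A / ?c"
    using c unfolding \<rho>_def by (simp_all add: real_root_pow_pos2 del: content_cball)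
  have "?Q \<rho>"
    unfolding measure_cball_power(1)[OF \<rho>(1)] \<rho>(2) using c \<rho>(1) by (simp del: content_cball)
  moreover have "r = r'" if "?Q r" "?Q r'" for r r'
    using that measure_cball_le_iff[of r r', where 'n = 'n] measure_cball_le_iff[of r' r, where 'n = 'n]
    by simp
  ultimately have "\<exists>!r. ?Q r" by blast
  then have "?Q (vol_radius A)" unfolding vol_radius_def by (rule theI')
  then show "0 \<le> vol_radius A" "measure lebesgue (cball (0::real^'n) (vol_radius A)) = measure lebesgue A"
    by blast+
qed

text \<open>Membership in a symmetrized set is thereby expressed by volumes, to which continuity of
  measures along decreasing sequences applies.\<close>

lemma le_vol_radius_iff:
  fixes A :: "(real^'n) set"
  assumes "0 \<le> a"
  shows "a \<le> vol_radius A \<longleftrightarrow> measure lebesgue (cball (0::real^'n) a) \<le> measure lebesgue A"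
  using measure_cball_le_iff[OF assms vol_radius(1)[of A], where 'n = 'n] unfolding vol_radius(2) by blast

lemma mem_sym_ball_iff:
  "x \<in> sym_ball A \<longleftrightarrow> A \<noteq> {} \<and> norm x \<le> vol_radius A"
  by (simp add: sym_ball_def vol_radius_def)

lemma measure_lebesgue_eq_lborel: "compact A \<Longrightarrow> measure lebesgue A = measure lborel A"
  by (simp add: measure_completion borel_compact)

text \<open>The Brunn-Minkowski inequality for convex bodies. The hypothesis, an inclusion of
  \<open>(1 - t) A + t B\<close> in \<open>C\<close>, is preserved by simultaneous Steiner symmetrization, since chords on
  parallel lines combine in the same way. Once \<open>A\<close> and \<open>B\<close> contain balls with almost their volume
  radii, the symmetral of \<open>C\<close>, whose volume is that of \<open>C\<close>, contains the combination of these balls.\<close>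

lemma brunn_minkowski_radius:
  fixes A B C :: "(real^'n) set"
  assumes A: "compact A" "convex A" "A \<noteq> {}" and B: "compact B" "convex B" "B \<noteq> {}"
    and C: "compact C" "convex C" and t: "0 \<le> t" "t \<le> 1"
    and ABC: "\<And>x y. x \<in> A \<Longrightarrow> y \<in> B \<Longrightarrow> (1 - t) *\<^sub>R x + t *\<^sub>R y \<in> C"
  shows "(1 - t) * vol_radius A + t * vol_radius B \<le> vol_radius C"
proof -
  define \<rho> where "\<rho> = (1 - t) * vol_radius A + t * vol_radius B"
  have \<rho>: "0 \<le> \<rho>" unfolding \<rho>_def using t vol_radius(1)[of A] vol_radius(1)[of B] by simp
  define K where "K i = (if i = 0 then A else if i = 1 then B else C)" for i :: nat
  let ?P = "\<lambda>K :: nat \<Rightarrow> (real^'n) set. \<forall>x\<in>K 0. \<forall>y\<in>K 1. (1 - t) *\<^sub>R x + t *\<^sub>R y \<in> K 2"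
  have inv: "steiner_invariant ?P"
    unfolding steiner_invariant_def
  proof (intro allI impI ballI)
    fix K :: "nat \<Rightarrow> (real^'n) set" and u x y
    assume u: "norm u = 1" and P: "?P K" and x: "x \<in> steiner u (K 0)" and y: "y \<in> steiner u (K 1)"
    obtain p a b where p: "x = p + ((a - b) / 2) *\<^sub>R u" "p \<bullet> u = 0" "p + a *\<^sub>R u \<in> K 0" "p + b *\<^sub>R u \<in> K 0"
      using x unfolding steiner_def by blast
    obtain q c d where q: "y = q + ((c - d) / 2) *\<^sub>R u" "q \<bullet> u = 0" "q + c *\<^sub>R u \<in> K 1" "q + d *\<^sub>R u \<in> K 1"
      using y unfolding steiner_def by blast
    let ?w = "(1 - t) *\<^sub>R p + t *\<^sub>R q"
    have comb: "(1 - t) *\<^sub>R (p + r *\<^sub>R u) + t *\<^sub>R (q + s *\<^sub>R u) = ?w + ((1 - t) * r + t * s) *\<^sub>R u" for r s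
      by (simp add: algebra_simps)
    have "?w \<bullet> u = 0" using p(2) q(2) by (simp add: inner_add_left)
    moreover have "?w + ((1 - t) * a + t * c) *\<^sub>R u \<in> K 2" "?w + ((1 - t) * b + t * d) *\<^sub>R u \<in> K 2"
      using P p(3,4) q(3,4) by (metis comb)+
    moreover have "(1 - t) *\<^sub>R x + t *\<^sub>R y
        = ?w + ((((1 - t) * a + t * c) - ((1 - t) * b + t * d)) / 2) *\<^sub>R u"
    proof -
      have "(1 - t) * ((a - b) / 2) + t * ((c - d) / 2) = (((1 - t) * a + t * c) - ((1 - t) * b + t * d)) / 2"
        by (simp add: field_simps)
      then show ?thesis unfolding p(1) q(1) comb by simp
    qed
    ultimately show "(1 - t) *\<^sub>R x + t *\<^sub>R y \<in> steiner u (K 2)"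
      unfolding steiner_def by blast
  qed
  have P: "?P K" using ABC by (simp add: K_def)
  have body: "compact (K i) \<and> convex (K i) \<and> K i \<noteq> {}" for i
  proof -
    have "C \<noteq> {}" using A(3) B(3) ABC by blast
    then show ?thesis using A B C by (simp add: K_def)
  qed
  have r: "0 \<le> vol_radius (K i) \<and> measure lborel (cball (0::real^'n) (vol_radius (K i))) = measure lborel (K i)" for i
    using vol_radius[of "K i"] body[of i] by (simp add: measure_lebesgue_eq_lborel)
  have less: "(1 - e) * \<rho> \<le> vol_radius C" if e: "0 < e" "e < 1" for e :: real
  proof -
    obtain K' where K': "?P K'" "\<And>i. i \<in> {0,1,2} \<Longrightarrow> compact (K' i) \<and> measure lborel (K' i) = measure lborel (K i)"
      "\<And>i. i \<in> {0,1,2} \<Longrightarrow> cball 0 ((1 - e) * vol_radius (K i)) \<subseteq> K' i"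
      by (rule exists_steiner_nearly_round[where I = "{0,1,2}" and r = "\<lambda>i. vol_radius (K i)" and P = ?P and K = K and e = e])
        (use inv P body r e in auto)
    have "cball 0 ((1 - e) * \<rho>) \<subseteq> K' 2"
    proof
      fix z :: "real^'n" assume z: "z \<in> cball 0 ((1 - e) * \<rho>)"
      show "z \<in> K' 2"
      proof (cases "\<rho> = 0")
        case True
        have "0 \<in> K' 2" using K'(3)[of 2] e vol_radius(1)[of "K 2"] by (auto simp: subset_iff)
        with z True show ?thesis by simp
      next
        case False
        with \<rho> have \<rho>: "0 < \<rho>" by simp
        \<comment> \<open>Split \<open>z\<close> in proportion to the two volume radii.\<close>
        have "(v / \<rho>) *\<^sub>R z \<in> cball 0 ((1 - e) * v)" if "0 \<le> v" for v
        proof -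
          have "norm ((v / \<rho>) *\<^sub>R z) = v / \<rho> * norm z" using that \<rho> by simp
          also have "\<dots> \<le> v / \<rho> * ((1 - e) * \<rho>)" using z that \<rho> by (intro mult_left_mono) auto
          also have "\<dots> = (1 - e) * v" using \<rho> by simp
          finally show ?thesis by simp
        qed
        then have "(vol_radius A / \<rho>) *\<^sub>R z \<in> K' 0" "(vol_radius B / \<rho>) *\<^sub>R z \<in> K' 1"
          using K'(3)[of 0] K'(3)[of 1] vol_radius(1)[of A] vol_radius(1)[of B] by (auto simp: K_def)
        then have "(1 - t) *\<^sub>R (vol_radius A / \<rho>) *\<^sub>R z + t *\<^sub>R (vol_radius B / \<rho>) *\<^sub>R z \<in> K' 2"
          using K'(1) by blast
        moreover have "(1 - t) *\<^sub>R (vol_radius A / \<rho>) *\<^sub>R z + t *\<^sub>R (vol_radius B / \<rho>) *\<^sub>R z = (\<rho> / \<rho>) *\<^sub>R z"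
          by (subst (3) \<rho>_def) (simp add: scaleR_add_left[symmetric] add_divide_distrib)
        ultimately show ?thesis using \<rho> by simp
      qed
    qed
    then have "measure lborel (cball (0::real^'n) ((1 - e) * \<rho>)) \<le> measure lborel (K' 2)"
      using K'(2)[of 2] by (intro measure_mono_fmeasurable) (auto simp: fmeasurable_compact)
    also have "\<dots> = measure lborel C" using K'(2)[of 2] by (simp add: K_def)
    finally have "measure lebesgue (cball (0::real^'n) ((1 - e) * \<rho>)) \<le> measure lebesgue C"
      using C(1) by (simp add: measure_lebesgue_eq_lborel)
    then show ?thesis using \<rho> e by (simp add: le_vol_radius_iff)
  qed
  have "\<rho> \<le> vol_radius C"
  proof (rule field_le_mult_one_interval)
    fix z :: real assume z: "0 < z" "z < 1"
    then show "z * \<rho> \<le> vol_radius C" using less[of "1 - z"] by simp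
  qed
  then show ?thesis by (simp add: \<rho>_def)
qed

section \<open>The symmetric decreasing rearrangement is log-concave\<close>

definition level :: "(real^'n \<Rightarrow> ereal) \<Rightarrow> real \<Rightarrow> (real^'n) set" where
  "level \<psi> s = {x. \<psi> x \<le> ereal s}"

lemma level_mono: "s \<le> t \<Longrightarrow> level \<psi> s \<subseteq> level \<psi> t"
  unfolding level_def by (auto intro: order_trans)

context
  fixes \<psi> :: "real^'n \<Rightarrow> ereal"
  assumes psi: "\<psi> \<in> Conv_c"
begin

lemma Conv_c_not_minus_infinity: "\<psi> x \<noteq> -\<infinity>"
  using psi by (simp add: Conv_c_def convex_fun_def)

lemma level_combination:
  assumes x: "x \<in> level \<psi> a" and y: "y \<in> level \<psi> b" and t: "0 \<le> t" "t \<le> 1"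
  shows "(1 - t) *\<^sub>R x + t *\<^sub>R y \<in> level \<psi> ((1 - t) * a + t * b)"
proof -
  consider "t = 0" | "t = 1" | "0 < t" "t < 1" using t by linarith
  then show ?thesis
  proof cases
    case 3
    have "\<psi> ((1 - t) *\<^sub>R x + t *\<^sub>R y) \<le> ereal (1 - t) * \<psi> x + ereal t * \<psi> y"
      using psi 3 by (simp add: Conv_c_def convex_fun_def)
    also have "\<dots> \<le> ereal (1 - t) * ereal a + ereal t * ereal b"
      using x y 3 by (intro add_mono ereal_mult_left_mono) (auto simp: level_def)
    finally show ?thesis by (simp add: level_def)
  qed (use x y in simp_all)
qed

lemma convex_level: "convex (level \<psi> s)"
  unfolding convex_alt using level_combination[where a = s and b = s] by (auto simp: algebra_simps)

lemma compact_level: "compact (level \<psi> s)"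
proof -
  have "closed (epi \<psi>)" using psi by (simp add: Conv_c_def)
  then have "closed ((\<lambda>x. (x, s)) -` epi \<psi>)"
    by (intro closed_vimage continuous_intros)
  then have "closed (level \<psi> s)" by (simp add: level_def epi_def vimage_def)
  moreover have "(\<psi> \<longlongrightarrow> \<infinity>) at_infinity" using psi by (simp add: Conv_c_def)
  then have "eventually (\<lambda>x. ereal s < \<psi> x) at_infinity" by (simp add: tendsto_PInfty)
  then obtain b where b: "\<And>x. b \<le> norm x \<Longrightarrow> ereal s < \<psi> x" by (auto simp: eventually_at_infinity)
  have "norm x \<le> b" if "x \<in> level \<psi> s" for x
    using that b[of x] by (cases "b \<le> norm x") (simp_all add: level_def not_le[symmetric])
  then have "bounded (level \<psi> s)" by (auto simp: bounded_iff)
  ultimately show ?thesis by (simp add: compact_eq_bounded_closed)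
qed

lemma level_Inter: "(\<Inter>k. level \<psi> (s + 1 / Suc k)) = level \<psi> s"
proof
  show "(\<Inter>k. level \<psi> (s + 1 / Suc k)) \<subseteq> level \<psi> s"
  proof
    fix x assume "x \<in> (\<Inter>k. level \<psi> (s + 1 / Suc k))"
    then have *: "\<psi> x \<le> ereal (s + 1 / Suc k)" for k by (auto simp: level_def)
    have "(\<lambda>k. ereal (s + 1 / Suc k)) \<longlonglongrightarrow> ereal (s + 0)"
      by (intro tendsto_ereal tendsto_intros LIMSEQ_inverse_real_of_nat[unfolded inverse_eq_divide])
    then have "\<psi> x \<le> ereal (s + 0)" by (rule LIMSEQ_le_const) (use * in blast)
    then show "x \<in> level \<psi> s" by (simp add: level_def)
  qed
  show "level \<psi> s \<subseteq> (\<Inter>k. level \<psi> (s + 1 / Suc k))"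
    by (intro INT_greatest level_mono) simp
qed

lemma decseq_level: "decseq (\<lambda>k. level \<psi> (s + 1 / Suc k))"
  by (intro decseq_SucI level_mono add_left_mono frac_le) auto

text \<open>Nonempty compact nested sets have a common point. With the next lemma this gives the
  right continuity of the levels that makes the rearrangement lower semicontinuous.\<close>

lemma level_nonempty_right: assumes "\<And>k. level \<psi> (s + 1 / Suc k) \<noteq> {}" shows "level \<psi> s \<noteq> {}"
proof -
  have "(\<Inter>k. level \<psi> (s + 1 / Suc k)) \<noteq> {}"
    using assms compact_level decseq_level by (intro compact_nest) (auto simp: decseq_def)
  then show ?thesis unfolding level_Inter .
qed

lemma measure_level_right:
  assumes "\<And>k. v \<le> measure lebesgue (level \<psi> (s + 1 / Suc k))"
  shows "v \<le> measure lebesgue (level \<psi> s)"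
proof -
  have "(\<lambda>k. measure lebesgue (level \<psi> (s + 1 / Suc k))) \<longlonglongrightarrow> measure lebesgue (\<Inter>k. level \<psi> (s + 1 / Suc k))"
    using compact_level[THEN fmeasurable_compact] compact_level[THEN lmeasurable_compact] decseq_level
    by (intro Lim_measure_decseq) (auto simp: fmeasurable_def less_top)
  then show ?thesis unfolding level_Inter
    by (rule LIMSEQ_le_const) (use assms in blast)
qed

lemma exists_empty_level: "\<exists>s. level \<psi> s = {}"
proof (rule ccontr)
  assume "\<nexists>s. level \<psi> s = {}"
  then have "(\<Inter>k. level \<psi> (- real k)) \<noteq> {}"
    using compact_level by (intro compact_nest level_mono) auto
  then obtain x where x: "\<psi> x \<le> ereal (- real k)" for k by (auto simp: level_def)
  have "\<psi> x = -\<infinity>"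
  proof (rule ereal_bot)
    fix B :: real
    obtain k where "- B < real k" using reals_Archimedean2 by blast
    then show "\<psi> x \<le> ereal B" using x[of k] by (intro order_trans[OF x[of k]]) simp
  qed
  then show False using Conv_c_not_minus_infinity by blast
qed

text \<open>The levels exhaust the effective domain, which is convex and not contained in a
  hyperplane, hence has interior points and is not a null set.\<close>

lemma exists_level_positive: "\<exists>s. 0 < measure lebesgue (level \<psi> s)"
proof (rule ccontr)
  assume "\<nexists>s. 0 < measure lebesgue (level \<psi> s)"
  then have "measure lebesgue (level \<psi> s) = 0" for s
    using zero_less_measure_iff[of lebesgue "level \<psi> s"] by auto
  then have neg: "negligible (level \<psi> s)" for s
    using compact_level by (simp add: negligible_iff_measure lmeasurable_compact)
  have "eff_dom \<psi> \<subseteq> (\<Union>k::nat. level \<psi> (real k))"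
  proof
    fix x assume "x \<in> eff_dom \<psi>"
    then obtain r where "\<psi> x = ereal r" using Conv_c_not_minus_infinity[of x] by (cases "\<psi> x") (auto simp: eff_dom_def)
    moreover obtain k where "r \<le> real k" using real_arch_simple by blast
    ultimately show "x \<in> (\<Union>k::nat. level \<psi> (real k))" by (auto simp: level_def)
  qed
  then have negdom: "negligible (eff_dom \<psi>)"
    using neg by (meson negligible_subset negligible_Union_nat)
  have "convex (eff_dom \<psi>)"
    unfolding convex_alt
  proof (intro ballI allI impI)
    fix x y and t :: real assume xy: "x \<in> eff_dom \<psi>" "y \<in> eff_dom \<psi>" and t: "0 \<le> t \<and> t \<le> 1"
    then obtain a b where "\<psi> x = ereal a" "\<psi> y = ereal b"
      using Conv_c_not_minus_infinity[of x] Conv_c_not_minus_infinity[of y] by (cases "\<psi> x"; cases "\<psi> y") (auto simp: eff_dom_def)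
    then have "(1 - t) *\<^sub>R x + t *\<^sub>R y \<in> level \<psi> ((1 - t) * a + t * b)"
      using t by (intro level_combination) (auto simp: level_def)
    then show "(1 - t) *\<^sub>R x + t *\<^sub>R y \<in> eff_dom \<psi>"
      by (auto simp: level_def eff_dom_def intro: le_less_trans)
  qed
  moreover have "\<not> (\<exists>a b. a \<noteq> 0 \<and> eff_dom \<psi> \<subseteq> {x. a \<bullet> x = b})" using psi by (simp add: Conv_c_def)
  ultimately have "interior (eff_dom \<psi>) \<noteq> {}"
    using empty_interior_subset_hyperplane by metis
  moreover have "negligible (interior (eff_dom \<psi>))" using negdom interior_subset negligible_subset by blast
  ultimately show False using open_not_negligible open_interior by blast
qed

text \<open>The convex function behind the symmetric decreasing rearrangement: it is the function
  whose sublevel sets are the balls with the volumes of the sublevel sets of \<open>\<psi>\<close>.\<close>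

definition psi_star :: "real^'n \<Rightarrow> ereal" where
  "psi_star x = Inf {ereal s | s. x \<in> sym_ball (level \<psi> s)}"

lemma sym_ball_level_mono: "x \<in> sym_ball (level \<psi> s) \<Longrightarrow> s \<le> t \<Longrightarrow> x \<in> sym_ball (level \<psi> t)"
proof -
  assume x: "x \<in> sym_ball (level \<psi> s)" and st: "s \<le> t"
  have "measure lebesgue (level \<psi> s) \<le> measure lebesgue (level \<psi> t)"
    using level_mono[OF st] compact_level by (intro measure_mono_fmeasurable) (auto simp: lmeasurable_compact fmeasurableD)
  with x level_mono[OF st, of \<psi>] show ?thesis by (auto simp: mem_sym_ball_iff le_vol_radius_iff)
qed

lemma sym_ball_level_right:
  assumes "\<And>k. x \<in> sym_ball (level \<psi> (s + 1 / Suc k))"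
  shows "x \<in> sym_ball (level \<psi> s)"
  using assms level_nonempty_right[of s] measure_level_right[of _ s]
  by (simp add: mem_sym_ball_iff le_vol_radius_iff)

text \<open>Where it is finite, the infimum in the definition is attained. This is where the right
  continuity of levels and of their volumes enters.\<close>

lemma level_psi_star: "level psi_star s = sym_ball (level \<psi> s)"
proof (intro equalityI subsetI)
  fix x assume "x \<in> level psi_star s"
  then have le: "psi_star x \<le> ereal s" by (simp add: level_def)
  show "x \<in> sym_ball (level \<psi> s)"
  proof (rule sym_ball_level_right)
    fix k
    have "psi_star x < ereal (s + 1 / Suc k)" using le by (rule le_less_trans) simp
    then obtain s' where "x \<in> sym_ball (level \<psi> s')" "s' < s + 1 / Suc k"
      unfolding psi_star_def Inf_less_iff by auto
    then show "x \<in> sym_ball (level \<psi> (s + 1 / Suc k))" using sym_ball_level_mono by (meson less_imp_le)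
  qed
next
  fix x assume "x \<in> sym_ball (level \<psi> s)"
  then show "x \<in> level psi_star s" unfolding level_def psi_star_def by (auto intro: Inf_lower)
qed

lemma psi_star_le_iff: "psi_star x \<le> ereal s \<longleftrightarrow> x \<in> sym_ball (level \<psi> s)"
  using level_psi_star[of s] by (auto simp: level_def)

lemma psi_star_not_minus_infinity: "psi_star x \<noteq> -\<infinity>"
proof
  assume "psi_star x = -\<infinity>"
  then have "x \<in> sym_ball (level \<psi> s)" for s using psi_star_le_iff[of x s] by simp
  then show False using exists_empty_level by (auto simp: mem_sym_ball_iff)
qed

lemma vol_radius_level_combination:
  assumes "level \<psi> a \<noteq> {}" "level \<psi> b \<noteq> {}" "0 \<le> t" "t \<le> 1"
  shows "(1 - t) * vol_radius (level \<psi> a) + t * vol_radius (level \<psi> b)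
    \<le> vol_radius (level \<psi> ((1 - t) * a + t * b))"
  using assms by (intro brunn_minkowski_radius compact_level convex_level level_combination)

lemma convex_psi_star: "convex_fun psi_star"
  unfolding convex_fun_def
proof (intro conjI allI impI psi_star_not_minus_infinity)
  fix x y :: "real^'n" and t :: real assume t: "0 < t \<and> t < 1"
  show "psi_star ((1 - t) *\<^sub>R x + t *\<^sub>R y) \<le> ereal (1 - t) * psi_star x + ereal t * psi_star y"
  proof (cases "psi_star x = \<infinity> \<or> psi_star y = \<infinity>")
    case True
    then have "ereal (1 - t) * psi_star x + ereal t * psi_star y = \<infinity>"
      using t psi_star_not_minus_infinity[of x] psi_star_not_minus_infinity[of y]
      by (cases "psi_star x"; cases "psi_star y") auto
    then show ?thesis by (simp only: ereal_less_eq(1))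
  next
    case False
    then obtain a b where ab: "psi_star x = ereal a" "psi_star y = ereal b"
      using psi_star_not_minus_infinity[of x] psi_star_not_minus_infinity[of y] by (cases "psi_star x"; cases "psi_star y") auto
    then have x: "level \<psi> a \<noteq> {}" "norm x \<le> vol_radius (level \<psi> a)"
      and y: "level \<psi> b \<noteq> {}" "norm y \<le> vol_radius (level \<psi> b)"
      using psi_star_le_iff[of x a] psi_star_le_iff[of y b] by (simp_all add: mem_sym_ball_iff)
    have "norm ((1 - t) *\<^sub>R x + t *\<^sub>R y) \<le> (1 - t) * norm x + t * norm y"
      using norm_triangle_ineq[of "(1 - t) *\<^sub>R x" "t *\<^sub>R y"] t by simp
    also have "\<dots> \<le> (1 - t) * vol_radius (level \<psi> a) + t * vol_radius (level \<psi> b)"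
      using x(2) y(2) t by (intro add_mono mult_left_mono) auto
    also have "\<dots> \<le> vol_radius (level \<psi> ((1 - t) * a + t * b))"
      using vol_radius_level_combination[OF x(1) y(1)] t by simp
    finally have "norm ((1 - t) *\<^sub>R x + t *\<^sub>R y) \<le> vol_radius (level \<psi> ((1 - t) * a + t * b))" .
    moreover have "level \<psi> ((1 - t) * a + t * b) \<noteq> {}"
      using level_combination[of _ a _ b t] x(1) y(1) t by fastforce
    ultimately have "psi_star ((1 - t) *\<^sub>R x + t *\<^sub>R y) \<le> ereal ((1 - t) * a + t * b)"
      by (simp add: psi_star_le_iff mem_sym_ball_iff)
    then show ?thesis by (simp add: ab)
  qed
qed

lemma closed_epi_psi_star: "closed (epi psi_star)"
  unfolding closed_sequential_limits
proof (intro allI impI)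
  fix q :: "nat \<Rightarrow> (real^'n) \<times> real" and l assume "(\<forall>n. q n \<in> epi psi_star) \<and> q \<longlonglongrightarrow> l"
  then have q: "\<And>n. fst (q n) \<in> sym_ball (level \<psi> (snd (q n)))" and lim: "q \<longlonglongrightarrow> l"
    by (auto simp: epi_def case_prod_unfold psi_star_le_iff)
  have "fst l \<in> sym_ball (level \<psi> (snd l))"
  proof (rule sym_ball_level_right)
    fix k
    have "eventually (\<lambda>n. snd (q n) < snd l + 1 / Suc k) sequentially"
      using tendsto_snd[OF lim] by (rule order_tendstoD) simp
    then have ev: "eventually (\<lambda>n. fst (q n) \<in> sym_ball (level \<psi> (snd l + 1 / Suc k))) sequentially"
      by (rule eventually_mono) (use q sym_ball_level_mono less_imp_le in blast)
    then have ev': "eventually (\<lambda>n. norm (fst (q n)) \<le> vol_radius (level \<psi> (snd l + 1 / Suc k))) sequentially"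
      by (rule eventually_mono) (simp add: mem_sym_ball_iff)
    have "norm (fst l) \<le> vol_radius (level \<psi> (snd l + 1 / Suc k))"
      using tendsto_upperbound[OF tendsto_norm[OF tendsto_fst[OF lim]] ev'] by simp
    moreover have "level \<psi> (snd l + 1 / Suc k) \<noteq> {}"
      using eventually_happens'[OF _ ev] by (auto simp: mem_sym_ball_iff)
    ultimately show "fst l \<in> sym_ball (level \<psi> (snd l + 1 / Suc k))" by (simp add: mem_sym_ball_iff)
  qed
  then show "l \<in> epi psi_star" by (simp add: epi_def case_prod_unfold psi_star_le_iff)
qed

text \<open>The class is closed under rearrangement. Convexity is the Brunn-Minkowski inequality for
  levels. The values tend to infinity because balls of finite radius contain the levels, and a
  level of positive volume yields a ball inside the domain, which therefore fits in no
  hyperplane.\<close>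

lemma psi_star_in_Conv_c: "psi_star \<in> Conv_c"
proof -
  have "(psi_star \<longlongrightarrow> \<infinity>) at_infinity"
    unfolding tendsto_PInfty
  proof
    fix r :: real
    have "ereal r < psi_star x" if "vol_radius (level \<psi> r) + 1 \<le> norm x" for x
      using that psi_star_le_iff[of x r] by (auto simp: mem_sym_ball_iff not_le[symmetric])
    then show "eventually (\<lambda>x. ereal r < psi_star x) at_infinity"
      by (auto simp: eventually_at_infinity)
  qed
  moreover obtain s where s: "0 < measure lebesgue (level \<psi> s)" using exists_level_positive by blast
  then have ne: "level \<psi> s \<noteq> {}" by auto
  have "vol_radius (level \<psi> s) \<noteq> 0"
    using vol_radius(2)[of "level \<psi> s"] s by auto
  with vol_radius(1)[of "level \<psi> s"] have r: "0 < vol_radius (level \<psi> s)" by simp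
  have ball: "x \<in> eff_dom psi_star" if "norm x \<le> vol_radius (level \<psi> s)" for x
  proof -
    have "psi_star x \<le> ereal s" using that ne by (simp add: psi_star_le_iff mem_sym_ball_iff)
    then show ?thesis by (auto simp: eff_dom_def intro: le_less_trans)
  qed
  then have 0: "0 \<in> eff_dom psi_star" using r by simp
  moreover have "\<exists>x. psi_star x \<noteq> \<infinity>" using 0 by (auto simp: eff_dom_def)
  moreover have "\<not> (\<exists>a b. a \<noteq> 0 \<and> eff_dom psi_star \<subseteq> {x. a \<bullet> x = b})"
  proof
    assume "\<exists>a b. a \<noteq> 0 \<and> eff_dom psi_star \<subseteq> {x. a \<bullet> x = b}"
    then obtain a b where a: "a \<noteq> 0" "eff_dom psi_star \<subseteq> {x. a \<bullet> x = b}" by blast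
    have "b = 0" using a(2) 0 by auto
    have "(vol_radius (level \<psi> s) / norm a) *\<^sub>R a \<in> eff_dom psi_star" using a(1) r by (intro ball) simp
    then have "a \<bullet> ((vol_radius (level \<psi> s) / norm a) *\<^sub>R a) = 0" using a(2) \<open>b = 0\<close> by auto
    then show False using a(1) r by simp
  qed
  ultimately show ?thesis
    using convex_psi_star closed_epi_psi_star by (simp add: Conv_c_def)
qed

lemma exp_neg_superlevel: "0 < t \<Longrightarrow> {x. t \<le> exp_neg \<psi> x} = level \<psi> (- ln t)"
  by (simp add: exp_neg_ge_iff Conv_c_not_minus_infinity level_def)

lemma exp_neg_star_superlevel: "0 < t \<Longrightarrow> {x. t \<le> exp_neg psi_star x} = sym_ball {x. t \<le> exp_neg \<psi> x}"
  using level_psi_star[of "- ln t"]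
  by (simp add: exp_neg_ge_iff Conv_c_not_minus_infinity psi_star_not_minus_infinity level_def)

text \<open>A nonnegative function is determined by its superlevel sets at positive heights, so the
  description of \<open>sym_rearr\<close> has at most one solution.\<close>

lemma sym_rearr_exp_neg: "sym_rearr (exp_neg \<psi>) = exp_neg psi_star"
  unfolding sym_rearr_def
proof (rule the_equality)
  show "(\<forall>x. 0 \<le> exp_neg psi_star x) \<and> (\<forall>t>0. {x. t \<le> exp_neg psi_star x} = sym_ball {x. t \<le> exp_neg \<psi> x})"
    by (simp add: exp_neg_nonneg exp_neg_star_superlevel)
next
  fix g assume g: "(\<forall>x. 0 \<le> g x) \<and> (\<forall>t>0. {x. t \<le> g x} = sym_ball {x. t \<le> exp_neg \<psi> x})"
  then have eq: "t \<le> g x \<longleftrightarrow> t \<le> exp_neg psi_star x" if "0 < t" for t x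
    using exp_neg_star_superlevel[OF that] that by blast
  show "g = exp_neg psi_star"
  proof
    fix x
    show "g x = exp_neg psi_star x"
    proof (rule antisym)
      show "g x \<le> exp_neg psi_star x"
        using eq[of "g x" x] exp_neg_nonneg[of psi_star x] by (cases "0 < g x") auto
      show "exp_neg psi_star x \<le> g x"
        using eq[of "exp_neg psi_star x" x] g by (cases "0 < exp_neg psi_star x") (auto simp: not_less intro: order_trans)
    qed
  qed
qed

end

section \<open>Break points\<close>

lemma ereal_eq_iff_real_bounds:
  fixes a b :: ereal
  assumes "\<And>s. a \<le> ereal s \<longleftrightarrow> b \<le> ereal s" shows "a = b"
proof -
  have "a \<le> b" if "\<And>s. b \<le> ereal s \<Longrightarrow> a \<le> ereal s" for a b :: ereal
  proof (cases b)
    case (real r) then show ?thesis using that[of r] by simp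
  next
    case MInf then have "a = -\<infinity>" using that by (intro ereal_bot) simp
    then show ?thesis by simp
  qed simp
  then show ?thesis using assms by (blast intro: antisym)
qed

lemma epi_inner_lin:
  "finite X \<Longrightarrow> epi (inner_lin X) = {p. \<exists>t\<le>snd p. (fst p, t) \<in> convex hull X}"
  by (auto simp: epi_def inner_lin_le_iff)

text \<open>An extreme point of the epigraph cannot lie strictly above the convex hull, being then
  inside a vertical segment; so it is an extreme point of the convex hull of \<open>X\<close>.\<close>

lemma break_points_inner_lin:
  assumes X: "finite X" shows "break_points (inner_lin X) \<subseteq> fst ` X"
proof
  fix x assume "x \<in> break_points (inner_lin X)"
  then obtain y where y: "(x, y) extreme_point_of (epi (inner_lin X))" by (auto simp: break_points_def)
  then obtain t where t: "t \<le> y" "(x, t) \<in> convex hull X"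
    by (auto simp: extreme_point_of_def epi_inner_lin[OF X])
  have "t = y"
  proof (rule ccontr)
    assume "t \<noteq> y"
    with t have ty: "t < y" by simp
    have "(x, y) \<in> open_segment (x, t) (x, y + (y - t))"
      using ty by (auto simp: in_segment intro!: exI[of _ "1/2"]) (simp_all add: field_simps)
    moreover have "(x, t) \<in> epi (inner_lin X)" "(x, y + (y - t)) \<in> epi (inner_lin X)"
      using t ty by (auto simp: epi_inner_lin[OF X] intro!: exI[of _ t])
    ultimately show False using y by (auto simp: extreme_point_of_def)
  qed
  with t have "(x, y) \<in> convex hull X" by simp
  moreover have "convex hull X \<subseteq> epi (inner_lin X)" by (auto simp: epi_inner_lin[OF X])
  ultimately have "(x, y) extreme_point_of (convex hull X)"
    using y unfolding extreme_point_of_def by blast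
  then have "(x, y) \<in> X" by (rule extreme_point_of_convex_hull)
  then show "x \<in> fst ` X" by force
qed

text \<open>The case \<open>\<alpha> = 0\<close> also covers an empty \<open>Y\<close>.\<close>

lemma convex_hull_insert_cases:
  fixes p :: "'b::real_vector"
  assumes "q \<in> convex hull (insert p Y)"
  obtains \<alpha> c where "0 \<le> \<alpha>" "q = (1 - \<alpha>) *\<^sub>R p + \<alpha> *\<^sub>R c" "\<alpha> = 0 \<or> c \<in> convex hull Y"
proof (cases "Y = {}")
  case True
  then show ?thesis using assms that[of 0 p] by simp
next
  case False
  then obtain u v b where "0 \<le> u" "0 \<le> v" "u + v = 1" "b \<in> convex hull Y" "q = u *\<^sub>R p + v *\<^sub>R b"
    using assms by (auto simp: convex_hull_insert)
  moreover have "u = 1 - v" using \<open>u + v = 1\<close> by simp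
  ultimately show ?thesis using that[of v b] by simp
qed

text \<open>If \<open>p\<close> is inside a segment from \<open>a\<close> to \<open>b\<close> in the epigraph, write \<open>a\<close> and \<open>b\<close> as points above
  combinations of \<open>p\<close> and of points in the hull of the remaining vertices. If the total weight \<open>\<gamma>\<close> of
  the remaining vertices is positive, solving for \<open>p\<close> shows that their hull contains a point on or
  below \<open>p\<close>, which is excluded. Otherwise \<open>a\<close> and \<open>b\<close> are vertically above \<open>p\<close>, hence equal to \<open>p\<close>.\<close>

lemma extreme_point_of_epi_inner_lin:
  fixes p :: "(real^'n) \<times> real"
  assumes X: "finite X" and p: "p \<in> X"
    and not: "\<And>t. t \<le> snd p \<Longrightarrow> (fst p, t) \<notin> convex hull (X - {p})"
  shows "p extreme_point_of (epi (inner_lin X))"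
  unfolding extreme_point_of_def
proof (intro conjI ballI notI)
  show "p \<in> epi (inner_lin X)"
    using p by (auto simp: epi_inner_lin[OF X] intro!: exI[of _ "snd p"] hull_inc)
  fix a b assume a: "a \<in> epi (inner_lin X)" and b: "b \<in> epi (inner_lin X)" and seg: "p \<in> open_segment a b"
  have ins: "X = insert p (X - {p})" using p by blast
  obtain \<theta> where \<theta>: "0 < \<theta>" "\<theta> < 1" "p = (1 - \<theta>) *\<^sub>R a + \<theta> *\<^sub>R b" and ab: "a \<noteq> b"
    using seg by (auto simp: in_segment)
  obtain s where s: "s \<le> snd a" "(fst a, s) \<in> convex hull (insert p (X - {p}))"
    using a ins unfolding epi_inner_lin[OF X] by auto
  obtain t where t: "t \<le> snd b" "(fst b, t) \<in> convex hull (insert p (X - {p}))"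
    using b ins unfolding epi_inner_lin[OF X] by auto
  obtain \<alpha> c where c: "0 \<le> \<alpha>" "(fst a, s) = (1 - \<alpha>) *\<^sub>R p + \<alpha> *\<^sub>R c" "\<alpha> = 0 \<or> c \<in> convex hull (X - {p})"
    by (rule convex_hull_insert_cases[OF s(2)])
  obtain \<beta> d where d: "0 \<le> \<beta>" "(fst b, t) = (1 - \<beta>) *\<^sub>R p + \<beta> *\<^sub>R d" "\<beta> = 0 \<or> d \<in> convex hull (X - {p})"
    by (rule convex_hull_insert_cases[OF t(2)])
  define \<gamma> where "\<gamma> = (1 - \<theta>) * \<alpha> + \<theta> * \<beta>"
  define T where "T = (1 - \<theta>) * s + \<theta> * t"
  have T: "T \<le> snd p"
  proof -
    have "T \<le> (1 - \<theta>) * snd a + \<theta> * snd b"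
      unfolding T_def using s(1) t(1) \<theta> by (intro add_mono mult_left_mono) auto
    also have "\<dots> = snd p" by (subst \<theta>(3)) simp
    finally show ?thesis .
  qed
  have "fst p = (1 - \<theta>) *\<^sub>R fst a + \<theta> *\<^sub>R fst b" by (subst \<theta>(3)) simp
  then have "(fst p, T) = (1 - \<theta>) *\<^sub>R (fst a, s) + \<theta> *\<^sub>R (fst b, t)"
    by (simp add: T_def)
  also have "\<dots> = (1 - \<gamma>) *\<^sub>R p + ((1 - \<theta>) * \<alpha>) *\<^sub>R c + (\<theta> * \<beta>) *\<^sub>R d"
    unfolding c(2) d(2) \<gamma>_def by (simp add: algebra_simps)
  finally have pT: "(fst p, T) = (1 - \<gamma>) *\<^sub>R p + ((1 - \<theta>) * \<alpha>) *\<^sub>R c + (\<theta> * \<beta>) *\<^sub>R d" .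
  have \<gamma>: "0 \<le> \<gamma>" using c(1) d(1) \<theta> by (simp add: \<gamma>_def)
  show False
  proof (cases "\<gamma> = 0")
    case True
    then have "\<alpha> = 0" "\<beta> = 0" using c(1) d(1) \<theta> unfolding \<gamma>_def
      by (smt (verit) mult_nonneg_nonneg mult_pos_pos)+
    then have eq: "fst a = fst p" "s = snd p" "fst b = fst p" "t = snd p"
      using c(2) d(2) by (simp_all add: prod_eq_iff)
    have "(1 - \<theta>) * (snd a - snd p) + \<theta> * (snd b - snd p) = 0"
    proof -
      have "snd p = (1 - \<theta>) * snd a + \<theta> * snd b" by (subst \<theta>(3)) simp
      then show ?thesis by (simp add: algebra_simps)
    qed
    moreover have "0 \<le> snd a - snd p" "0 \<le> snd b - snd p" using s(1) t(1) eq by auto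
    ultimately have "snd a - snd p = 0" "snd b - snd p = 0"
      using \<theta> by (smt (verit) mult_nonneg_nonneg mult_pos_pos)+
    then show False using eq ab by (simp add: prod_eq_iff)
  next
    case False
    with \<gamma> have \<gamma>: "0 < \<gamma>" by simp
    define e where "e = ((1 - \<theta>) * \<alpha> / \<gamma>) *\<^sub>R c + (\<theta> * \<beta> / \<gamma>) *\<^sub>R d"
    have sum1: "(1 - \<theta>) * \<alpha> / \<gamma> + \<theta> * \<beta> / \<gamma> = 1"
      using \<gamma> by (simp add: \<gamma>_def flip: add_divide_distrib)
    have e: "e \<in> convex hull (X - {p})"
    proof (cases "\<alpha> = 0 \<or> \<beta> = 0")
      case True
      then have "e = d \<and> \<beta> \<noteq> 0 \<or> e = c \<and> \<alpha> \<noteq> 0"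
        using sum1 by (auto simp: e_def)
      then show ?thesis using c(3) d(3) by auto
    next
      case False
      then show ?thesis unfolding e_def using c d \<theta> \<gamma> sum1
        by (intro convexD[OF convex_convex_hull]) auto
    qed
    have "((1 - \<theta>) * \<alpha>) *\<^sub>R c + (\<theta> * \<beta>) *\<^sub>R d = \<gamma> *\<^sub>R e"
      using \<gamma> by (simp add: e_def scaleR_add_right)
    then have "(fst p, T) = (1 - \<gamma>) *\<^sub>R p + \<gamma> *\<^sub>R e" using pT by (simp add: add.assoc)
    then have "fst p = (1 - \<gamma>) *\<^sub>R fst p + \<gamma> *\<^sub>R fst e" and "T = (1 - \<gamma>) * snd p + \<gamma> * snd e"
      by (simp_all add: prod_eq_iff)
    then have "\<gamma> *\<^sub>R fst e = \<gamma> *\<^sub>R fst p" "\<gamma> * (snd e - snd p) = T - snd p"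
      by (auto simp: algebra_simps)
    then have "fst e = fst p" "\<gamma> * (snd e - snd p) \<le> 0"
      using \<gamma> T by simp_all
    then have "fst e = fst p" "snd e \<le> snd p"
      using \<gamma> by (simp_all add: mult_le_0_iff)
    then show False using not[of "snd e"] e by (metis prod.collapse)
  qed
qed

text \<open>A bound on break points is turned into a bound on vertices. In a subset of \<open>X\<close> of least
  cardinality with the same inner linearization no vertex lies on or above the hull of the others.
  Therefore every vertex is an extreme point of the epigraph, and distinct vertices have distinct
  projections.\<close>

lemma inner_lin_reduce:
  assumes X: "finite X" "X \<noteq> {}"
  obtains Y where "Y \<subseteq> X" "Y \<noteq> {}" "inner_lin Y = inner_lin X" "card Y \<le> card (break_points (inner_lin X))"
proof -
  let ?P = "\<lambda>Y. Y \<subseteq> X \<and> inner_lin Y = inner_lin X"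
  \<comment> \<open>A set of least cardinality that spans the same function.\<close>
  obtain Y where Y: "?P Y" and min: "\<And>Z. ?P Z \<Longrightarrow> card Y \<le> card Z"
    using arg_min_nat_lemma[of ?P X card] by blast
  have fin: "finite Y" using Y X finite_subset by blast
  have ne: "Y \<noteq> {}"
  proof
    assume "Y = {}"
    obtain p where "p \<in> X" using X by blast
    then have "inner_lin X (fst p) \<le> ereal (snd p)"
      by (auto simp: inner_lin_le_iff[OF X(1)] intro!: exI[of _ "snd p"] hull_inc)
    moreover have "inner_lin Y (fst p) = \<infinity>" using \<open>Y = {}\<close> by (simp add: inner_lin_def)
    ultimately show False using Y by simp
  qed
  have not: "(fst p, t) \<notin> convex hull (Y - {p})" if p: "p \<in> Y" and t: "t \<le> snd p" for p t
  proof
    assume in_hull: "(fst p, t) \<in> convex hull (Y - {p})"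
    \<comment> \<open>If \<open>p\<close> lies on or above the hull of the other vertices, the set above that hull contains all
      vertices, so \<open>p\<close> can be dropped without changing the function.\<close>
    let ?U = "{q. \<exists>t\<le>snd q. (fst q, t) \<in> convex hull (Y - {p})}"
    have "convex hull Y \<subseteq> ?U"
    proof (rule hull_minimal)
      show "Y \<subseteq> ?U"
      proof
        fix q assume q: "q \<in> Y"
        show "q \<in> ?U"
        proof (cases "q = p")
          case True then show ?thesis using in_hull t by auto
        next
          case False
          then have "q \<in> convex hull (Y - {p})" using q by (simp add: hull_inc)
          then show ?thesis by (auto intro!: exI[of _ "snd q"])
        qed
      qed
      show "convex ?U"
      proof (rule convexI)
        fix a b :: "(real^'a) \<times> real" and u v :: real
        assume "a \<in> ?U" "b \<in> ?U" and uv: "0 \<le> u" "0 \<le> v" "u + v = 1"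
        then obtain s t where st: "s \<le> snd a" "(fst a, s) \<in> convex hull (Y - {p})"
          "t \<le> snd b" "(fst b, t) \<in> convex hull (Y - {p})" by blast
        have "u *\<^sub>R (fst a, s) + v *\<^sub>R (fst b, t) \<in> convex hull (Y - {p})"
          using st uv by (intro convexD[OF convex_convex_hull])
        moreover have "u * s + v * t \<le> u * snd a + v * snd b"
          using st uv by (intro add_mono mult_left_mono) auto
        ultimately show "u *\<^sub>R a + v *\<^sub>R b \<in> ?U"
          by (auto intro!: exI[of _ "u * s + v * t"])
      qed
    qed
    then have sub: "\<exists>t'\<le>t. (z, t') \<in> convex hull (Y - {p})" if "(z, t) \<in> convex hull Y" for z t
      using that by force
    have "inner_lin (Y - {p}) z = inner_lin Y z" for z
    proof (rule ereal_eq_iff_real_bounds)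
      fix s show "inner_lin (Y - {p}) z \<le> ereal s \<longleftrightarrow> inner_lin Y z \<le> ereal s"
        using sub[of z] hull_mono[of "Y - {p}" Y convex] fin
        by (simp add: inner_lin_le_iff) (meson Diff_subset order_trans subsetD)
    qed
    then have "?P (Y - {p})" using Y by auto
    then have "card Y \<le> card (Y - {p})" by (rule min)
    then show False using card_Diff1_less[OF fin p] by simp
  qed
  have "fst ` Y \<subseteq> break_points (inner_lin X)"
  proof
    fix x assume "x \<in> fst ` Y"
    then obtain p where p: "p \<in> Y" "x = fst p" by blast
    have "p extreme_point_of (epi (inner_lin Y))"
      using extreme_point_of_epi_inner_lin[OF fin p(1)] not[OF p(1)] by blast
    then show "x \<in> break_points (inner_lin X)" using Y p by (auto simp: break_points_def intro!: exI[of _ "snd p"])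
  qed
  then have "card (fst ` Y) \<le> card (break_points (inner_lin X))"
    by (intro card_mono finite_subset[OF break_points_inner_lin[OF X(1)]] finite_imageI X)
  moreover have "inj_on fst Y"
  proof (rule inj_onI, rule ccontr)
    fix p q assume pq: "p \<in> Y" "q \<in> Y" "fst p = fst q" "p \<noteq> q"
    show False
    proof (cases "snd q \<le> snd p")
      case True
      have "q \<in> convex hull (Y - {p})" using pq by (intro hull_inc) auto
      then show ?thesis using not[OF pq(1) True] pq(3) by simp
    next
      case False
      have "p \<in> convex hull (Y - {q})" using pq by (intro hull_inc) auto
      then show ?thesis using not[OF pq(2), of "snd p"] False pq(3)[symmetric] by simp
    qed
  qed
  ultimately have "card Y \<le> card (break_points (inner_lin X))" by (simp add: card_image)
  then show thesis using that Y ne by blast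
qed

lemma mem_epi_iff:
  assumes "\<psi> \<in> Conv_c"
  shows "p \<in> epi \<psi> \<longleftrightarrow> exp (- snd p) \<le> exp_neg \<psi> (fst p)"
  using exp_neg_ge_iff[of \<psi> "fst p" "exp (- snd p)"] Conv_c_not_minus_infinity[OF assms, of "fst p"]
  by (simp add: epi_def case_prod_unfold)

text \<open>Log-linearizations with at most \<open>N\<close> break points are exactly those spanned by at most \<open>N\<close>
  points of the epigraph, by this lemma and the next. Any function of the
  class that represents \<open>exp_neg \<psi>\<close> has the epigraph of \<open>\<psi>\<close>, since \<open>mem_epi_iff\<close> recovers it from
  \<open>exp_neg \<psi>\<close>.\<close>

lemma inner_log_linearizationsE:
  assumes q: "q \<in> inner_log_linearizations N (exp_neg \<psi>)" and psi: "\<psi> \<in> Conv_c"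
  obtains X where "finite X" "X \<noteq> {}" "card X \<le> N" "X \<subseteq> epi \<psi>" "q = exp_neg (inner_lin X)"
proof -
  obtain p \<psi>' where 1: "q = exp_neg p" "\<psi>' \<in> Conv_c" "exp_neg \<psi> = exp_neg \<psi>'" "p \<in> inner_linearizations N \<psi>'"
    using q unfolding inner_log_linearizations_def by blast
  then obtain X where X: "p = inner_lin X" "finite X" "X \<noteq> {}" "X \<subseteq> epi \<psi>'" "card (break_points (inner_lin X)) \<le> N"
    unfolding inner_linearizations_def by blast
  obtain Y where Y: "Y \<subseteq> X" "Y \<noteq> {}" "inner_lin Y = inner_lin X" "card Y \<le> card (break_points (inner_lin X))"
    by (rule inner_lin_reduce[OF X(2,3)])
  have "epi \<psi>' = epi \<psi>" using 1(2,3) psi by (auto simp: mem_epi_iff)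
  then have "Y \<subseteq> epi \<psi>" using Y(1) X(4) by blast
  moreover have "finite Y" using Y(1) X(2) finite_subset by blast
  moreover have "card Y \<le> N" using Y(4) X(5) by simp
  moreover have "q = exp_neg (inner_lin Y)" using 1(1) X(1) Y(3) by simp
  ultimately show thesis using that Y(2) by blast
qed

lemma inner_log_linearizationsI:
  assumes psi: "\<psi> \<in> Conv_c" and X: "finite X" "X \<noteq> {}" "card X \<le> N" "X \<subseteq> epi \<psi>"
  shows "exp_neg (inner_lin X) \<in> inner_log_linearizations N (exp_neg \<psi>)"
proof -
  have "finite (break_points (inner_lin X))"
    using break_points_inner_lin[OF X(1)] X(1) finite_subset by blast
  moreover have "card (break_points (inner_lin X)) \<le> N"
    using card_mono[OF _ break_points_inner_lin[OF X(1)]] card_image_le[OF X(1), of fst] X(1,3) by simp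
  ultimately have "inner_lin X \<in> inner_linearizations N \<psi>"
    unfolding inner_linearizations_def using X by blast
  then show ?thesis unfolding inner_log_linearizations_def using psi by blast
qed

text \<open>The hull of points of the convex set \<open>epi \<psi>\<close> stays in it, so inner linearizations lie
  above \<open>\<psi>\<close>.\<close>

lemma exp_neg_inner_lin_le:
  assumes psi: "\<psi> \<in> Conv_c" and X: "finite X" "X \<subseteq> epi \<psi>"
  shows "exp_neg (inner_lin X) z \<le> exp_neg \<psi> z"
proof (cases "exp_neg (inner_lin X) z \<le> 0")
  case True then show ?thesis using exp_neg_nonneg[of \<psi> z] by linarith
next
  case False
  define t where "t = exp_neg (inner_lin X) z"
  have t: "0 < t" using False by (simp add: t_def)
  have "convex (epi \<psi>)"
    unfolding convex_alt
  proof (intro ballI allI impI)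
    fix p q and u :: real assume "p \<in> epi \<psi>" "q \<in> epi \<psi>" "0 \<le> u \<and> u \<le> 1"
    then show "(1 - u) *\<^sub>R p + u *\<^sub>R q \<in> epi \<psi>"
      using level_combination[OF psi, of "fst p" "snd p" "fst q" "snd q" u]
      by (simp add: epi_def level_def case_prod_unfold)
  qed
  then have hull: "convex hull X \<subseteq> epi \<psi>" using X(2) by (intro hull_minimal)
  have "inner_lin X z \<le> ereal (- ln t)"
    using exp_neg_ge_iff[of "inner_lin X" z t] t inner_lin_not_minus_infinity[of X z] by (simp add: t_def)
  then obtain s where "s \<le> - ln t" "(z, s) \<in> convex hull X" by (auto simp: inner_lin_le_iff[OF X(1)])
  then have "\<psi> z \<le> ereal (- ln t)" using hull by (auto simp: epi_def intro: order_trans)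
  then show ?thesis
    using exp_neg_ge_iff[of \<psi> z t] t Conv_c_not_minus_infinity[OF psi, of z] by (simp add: t_def)
qed

section \<open>Finiteness and invariance of the total mass\<close>

lemma nn_integral_exp_abs_finite:
  fixes c :: real
  assumes c: "0 < c"
  shows "(\<integral>\<^sup>+t. exp (- (c * \<bar>t::real\<bar>)) \<partial>lborel) < \<infinity>"
proof -
  define h :: "real \<Rightarrow> ennreal" where "h t = ennreal (exp (- (c * t))) * indicator {0..} t" for t
  have [measurable]: "h \<in> borel_measurable borel" unfolding h_def by measurable
  have lim: "((\<lambda>t. - exp (- (c * t)) / c) \<longlongrightarrow> - 0 / c) at_top"
  proof (intro tendsto_intros filterlim_compose[OF exp_at_bot])
    show "filterlim (\<lambda>t. - (c * t)) at_bot at_top"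
      using c filterlim_tendsto_pos_mult_at_top[OF tendsto_const c filterlim_ident]
      by (simp add: filterlim_uminus_at_bot)
  qed (use c in simp)
  have "(\<integral>\<^sup>+t. h t \<partial>lborel) = ennreal (- 0 / c - (- exp (- (c * 0)) / c))"
    unfolding h_def
    by (rule nn_integral_FTC_atLeast[OF _ _ _ lim]) (use c in \<open>auto intro!: derivative_eq_intros\<close>)
  then have fin: "(\<integral>\<^sup>+t. h t \<partial>lborel) < \<infinity>" by simp
  have "(\<integral>\<^sup>+t. h (- t) \<partial>lborel) = (\<integral>\<^sup>+t. h t \<partial>distr lborel borel uminus)"
    by (rule nn_integral_distr[symmetric]) auto
  also have "distr lborel borel uminus = (lborel :: real measure)"
    by (rule lborel_distr_uminus)
  finally have fin': "(\<integral>\<^sup>+t. h (- t) \<partial>lborel) < \<infinity>" using fin by simp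
  have "(\<integral>\<^sup>+t. exp (- (c * \<bar>t::real\<bar>)) \<partial>lborel) \<le> (\<integral>\<^sup>+t. h t + h (- t) \<partial>lborel)"
    by (intro nn_integral_mono) (auto simp: h_def indicator_def abs_if)
  also have "\<dots> = (\<integral>\<^sup>+t. h t \<partial>lborel) + (\<integral>\<^sup>+t. h (- t) \<partial>lborel)"
    by (rule nn_integral_add) auto
  also have "\<dots> < \<infinity>" using fin fin' by simp
  finally show ?thesis .
qed

text \<open>Bounding the norm from below by the mean of the absolute values of the coordinates
  reduces the claim to a product of one-dimensional integrals.\<close>

lemma nn_integral_exp_norm_finite:
  fixes c :: real
  assumes c: "0 < c"
  shows "(\<integral>\<^sup>+x. exp (- (c * norm (x::'a::euclidean_space))) \<partial>lborel) < \<infinity>"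
proof -
  let ?d = "c / DIM('a)"
  have d: "0 < ?d" using c by simp
  have "exp (- (c * norm x)) \<le> (\<Prod>b\<in>Basis. exp (- (?d * \<bar>x \<bullet> b\<bar>)))" for x :: 'a
  proof -
    have "(\<Sum>b\<in>Basis. \<bar>x \<bullet> b\<bar>) \<le> (\<Sum>b\<in>(Basis::'a set). norm x)"
      by (intro sum_mono Basis_le_norm)
    then have "?d * (\<Sum>b\<in>Basis. \<bar>x \<bullet> b\<bar>) \<le> ?d * (DIM('a) * norm x)"
      using d by (intro mult_left_mono) auto
    then have "(\<Sum>b\<in>Basis. ?d * \<bar>x \<bullet> b\<bar>) \<le> c * norm x" by (simp add: sum_distrib_left)
    then have "exp (- (c * norm x)) \<le> exp (\<Sum>b\<in>Basis. - (?d * \<bar>x \<bullet> b\<bar>))"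
      by (simp add: sum_negf)
    then show ?thesis by (simp add: exp_sum)
  qed
  then have "(\<integral>\<^sup>+x. exp (- (c * norm (x::'a))) \<partial>lborel)
      \<le> (\<integral>\<^sup>+x. (\<Prod>b\<in>(Basis::'a set). exp (- (?d * \<bar>x \<bullet> b\<bar>))) \<partial>lborel)"
    by (intro nn_integral_mono ennreal_leI)
  also have "\<dots> = (\<integral>\<^sup>+x. (\<Prod>b\<in>(Basis::'a set). ennreal (exp (- (?d * \<bar>x \<bullet> b\<bar>)))) \<partial>lborel)"
    by (simp add: prod_ennreal)
  also have "\<dots> = (\<Prod>b\<in>(Basis::'a set). (\<integral>\<^sup>+t. ennreal (exp (- (?d * \<bar>t\<bar>))) \<partial>lborel))"
    by (rule nn_integral_lborel_prod) auto
  also have "\<dots> < \<infinity>"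
    using nn_integral_exp_abs_finite[OF d] by (simp add: ennreal_prod_eq_top less_top power_less_top_ennreal)
  finally show ?thesis .
qed

text \<open>A coercive convex function grows at least linearly: outside a ball of radius \<open>R\<close> it
  exceeds \<open>\<psi> 0 + 1\<close>, and convexity along rays from the origin turns this into the bound
  \<open>\<psi> 0 + norm x / R\<close>. Inside the ball the function is bounded from below. Finiteness is what makes
  the set of errors in the definition of \<open>G\<close> bounded below and masses comparable as real numbers.\<close>

lemma nn_integral_exp_neg_finite:
  assumes psi: "\<psi> \<in> Conv_c"
  shows "(\<integral>\<^sup>+x. exp_neg \<psi> x \<partial>lborel) < \<infinity>"
proof -
  obtain s0 where s0: "level \<psi> s0 = {}" using exists_empty_level[OF psi] by blast
  have bound: "exp_neg \<psi> x \<le> exp (- s)" if "x \<notin> level \<psi> s" for x s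
    using that exp_neg_ge_iff[of \<psi> x "exp (- s)"] Conv_c_not_minus_infinity[OF psi, of x] by (simp add: level_def)
  have "0 \<in> eff_dom \<psi>" using psi by (simp add: Conv_c_def)
  then obtain a where a: "\<psi> 0 = ereal a" using Conv_c_not_minus_infinity[OF psi, of 0] by (cases "\<psi> 0") (auto simp: eff_dom_def)
  obtain R0 where R0: "\<And>x. x \<in> level \<psi> (a + 1) \<Longrightarrow> norm x \<le> R0"
    using compact_imp_bounded[OF compact_level[OF psi, of "a + 1"]] unfolding bounded_iff by blast
  define R where "R = \<bar>R0\<bar> + 1"
  have R: "0 < R" by (simp add: R_def)
  have level_R: "norm x < R" if "x \<in> level \<psi> (a + 1)" for x
    using R0[OF that] by (simp add: R_def)
  have decay: "exp_neg \<psi> x \<le> exp (- a) * exp (- (1 / R * norm x))" if x: "R \<le> norm x" for x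
  proof (cases "exp_neg \<psi> x \<le> 0")
    case True then show ?thesis by (rule order_trans) simp
  next
    case False
    define b where "b = - ln (exp_neg \<psi> x)"
    have eb: "exp_neg \<psi> x = exp (- b)" using False by (simp add: b_def)
    have "x \<in> level \<psi> b" using exp_neg_ge_iff[of \<psi> x "exp (- b)"] Conv_c_not_minus_infinity[OF psi, of x] eb by (simp add: level_def)
    define t where "t = R / norm x"
    have nx: "0 < norm x" using x R by linarith
    then have t: "0 \<le> t" "t \<le> 1" using x R by (simp_all add: t_def)
    have "t *\<^sub>R x \<notin> level \<psi> (a + 1)" using R level_R[of "t *\<^sub>R x"] nx by (auto simp: t_def)
    moreover have "t *\<^sub>R x \<in> level \<psi> ((1 - t) * a + t * b)"
      using level_combination[OF psi _ \<open>x \<in> level \<psi> b\<close> t, of 0 a] a by (simp add: level_def)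
    ultimately have "\<not> (1 - t) * a + t * b \<le> a + 1"
      using level_mono by blast
    then have "1 \<le> t * (b - a)" by (simp add: algebra_simps)
    then have "a + 1 / R * norm x \<le> b" using nx R by (simp add: t_def field_simps)
    then show ?thesis by (simp add: eb exp_add[symmetric])
  qed
  \<comment> \<open>Inside the ball the exponential factor is at least \<open>exp (- 1)\<close>, which \<open>exp 1\<close> compensates.\<close>
  define C where "C = exp (- s0) * exp 1 + exp (- a)"
  have C: "0 \<le> C" by (simp add: C_def)
  have "exp_neg \<psi> x \<le> C * exp (- (1 / R * norm x))" for x
  proof (cases "R \<le> norm x")
    case True
    show ?thesis by (rule order_trans[OF decay[OF True]]) (simp add: C_def)
  next
    case False
    have "exp_neg \<psi> x \<le> exp (- s0)" using bound[of x s0] s0 by simp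
    also have "exp (- s0) = exp (- s0) * exp 1 * exp (- 1)" by (simp add: exp_add[symmetric])
    also have "\<dots> \<le> C * exp (- (1 / R * norm x))"
      using False R by (intro mult_mono) (simp_all add: C_def field_simps)
    finally show ?thesis .
  qed
  then have "(\<integral>\<^sup>+x. exp_neg \<psi> x \<partial>lborel) \<le> (\<integral>\<^sup>+x. ennreal C * exp (- (1 / R * norm (x::real^'a))) \<partial>lborel)"
    using C by (intro nn_integral_mono) (simp add: ennreal_mult[symmetric] ennreal_leI)
  also have "\<dots> = ennreal C * (\<integral>\<^sup>+x. exp (- (1 / R * norm (x::real^'a))) \<partial>lborel)"
    by (rule nn_integral_cmult) simp
  also have "\<dots> < \<infinity>"
    using nn_integral_exp_norm_finite[of "1 / R", where 'a = "real^'a"] R by (simp add: ennreal_mult_less_top)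
  finally show ?thesis .
qed

lemma borel_measurable_exp_neg_Conv_c:
  assumes psi: "\<psi> \<in> Conv_c" shows "exp_neg \<psi> \<in> borel_measurable borel"
proof (rule borel_measurable_exp_neg[OF Conv_c_not_minus_infinity[OF psi]])
  fix s show "closed {z. \<psi> z \<le> ereal s}"
    using compact_level[OF psi, of s] by (simp add: level_def compact_imp_closed)
qed

text \<open>Corresponding superlevel sets have the same volume, and by the layer cake formula these
  volumes determine the integral.\<close>

lemma nn_integral_psi_star:
  fixes \<psi> :: "real^'n \<Rightarrow> ereal"
  assumes psi: "\<psi> \<in> Conv_c"
  shows "(\<integral>\<^sup>+x. exp_neg (psi_star \<psi>) x \<partial>lborel) = (\<integral>\<^sup>+x. exp_neg \<psi> x \<partial>lborel)"
proof -
  have star: "psi_star \<psi> \<in> Conv_c" by (rule psi_star_in_Conv_c[OF psi])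
  have eq: "emeasure lborel (sym_ball (level \<psi> s)) = emeasure lborel (level \<psi> s)" for s
  proof (cases "level \<psi> s = {}")
    case True then show ?thesis by (simp add: sym_ball_def)
  next
    case False
    then have ball: "sym_ball (level \<psi> s) = cball 0 (vol_radius (level \<psi> s))"
      by (auto simp: mem_sym_ball_iff)
    have c: "compact (cball (0::real^'n) (vol_radius (level \<psi> s)))" by simp
    have "measure lborel (cball (0::real^'n) (vol_radius (level \<psi> s))) = measure lborel (level \<psi> s)"
      using vol_radius(2)[of "level \<psi> s"]
      unfolding measure_lebesgue_eq_lborel[OF c] measure_lebesgue_eq_lborel[OF compact_level[OF psi]] .
    then show ?thesis unfolding ball
      using fmeasurable_compact[OF c] fmeasurable_compact[OF compact_level[OF psi, of s]]
      by (simp add: emeasure_eq_measure2)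
  qed
  have "indicator {0<..} t * emeasure lborel {z. t \<le> exp_neg (psi_star \<psi>) z}
      = indicator {0<..} t * emeasure lborel {z. t \<le> exp_neg \<psi> z}" for t
    using exp_neg_superlevel[OF psi, of t] exp_neg_superlevel[OF star, of t] level_psi_star[OF psi, of "- ln t"] eq
    by (cases "0 < t") simp_all
  then show ?thesis
    unfolding layer_cake(1)[OF borel_measurable_exp_neg_Conv_c[OF star] exp_neg_nonneg]
      layer_cake(1)[OF borel_measurable_exp_neg_Conv_c[OF psi] exp_neg_nonneg] by simp
qed

section \<open>The rearrangement inequality\<close>

lemma hull_mass_id: "hull_mass X fst snd = (\<integral>\<^sup>+z. exp_neg (inner_lin X) z \<partial>lborel)"
  by (simp add: hull_mass_def)

theorem theorem1p1:
  fixes N :: nat and f :: "real^'n \<Rightarrow> real"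
  assumes "N \<ge> CARD('n) + 2"
    and "f \<in> LC_c"
  shows "G N f \<le> G N (sym_rearr f)"
proof -
  obtain \<psi> :: "real^'n \<Rightarrow> ereal" where psi: "\<psi> \<in> Conv_c" and f: "f = exp_neg \<psi>"
    using assms(2) unfolding LC_c_def by blast
  define \<phi> where "\<phi> = psi_star \<psi>"
  have phi: "\<phi> \<in> Conv_c" unfolding \<phi>_def by (rule psi_star_in_Conv_c[OF psi])
  have fs: "sym_rearr f = exp_neg \<phi>" unfolding f \<phi>_def by (rule sym_rearr_exp_neg[OF psi])
  have mass_eq: "total_mass (exp_neg \<phi>) = total_mass f"
    unfolding f total_mass_eq_nn_integral[OF borel_measurable_exp_neg_Conv_c[OF phi] exp_neg_nonneg]
      total_mass_eq_nn_integral[OF borel_measurable_exp_neg_Conv_c[OF psi] exp_neg_nonneg]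
    by (simp add: \<phi>_def nn_integral_psi_star[OF psi])
  have finite_mass: "(\<integral>\<^sup>+x. exp_neg (inner_lin X) x \<partial>lborel) < \<infinity>" "total_mass (exp_neg (inner_lin X)) \<le> total_mass f"
    if X: "finite X" "X \<subseteq> epi \<psi>" for X
  proof -
    have le: "(\<integral>\<^sup>+x. exp_neg (inner_lin X) x \<partial>lborel) \<le> (\<integral>\<^sup>+x. exp_neg \<psi> x \<partial>lborel)"
      by (intro nn_integral_mono ennreal_leI exp_neg_inner_lin_le[OF psi X])
    then show "(\<integral>\<^sup>+x. exp_neg (inner_lin X) x \<partial>lborel) < \<infinity>"
      using nn_integral_exp_neg_finite[OF psi] by (rule le_less_trans)
    show "total_mass (exp_neg (inner_lin X)) \<le> total_mass f"
      unfolding f total_mass_eq_nn_integral[OF borel_measurable_inner_lin[OF X(1)] exp_neg_nonneg]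
        total_mass_eq_nn_integral[OF borel_measurable_exp_neg_Conv_c[OF psi] exp_neg_nonneg]
      using le nn_integral_exp_neg_finite[OF psi] by (intro enn2real_mono) auto
  qed
  have G_le: "G N f \<le> total_mass f - total_mass (exp_neg (inner_lin X))"
    if X: "finite X" "X \<noteq> {}" "card X \<le> N" "X \<subseteq> epi \<psi>" for X
    unfolding G_def
  proof (rule cINF_lower)
    show "exp_neg (inner_lin X) \<in> inner_log_linearizations N f"
      unfolding f by (rule inner_log_linearizationsI[OF psi X])
    show "bdd_below ((\<lambda>p. total_mass f - total_mass p) ` inner_log_linearizations N f)"
    proof (rule bdd_belowI2)
      fix q assume "q \<in> inner_log_linearizations N f"
      then obtain Y where "finite Y" "Y \<subseteq> epi \<psi>" "q = exp_neg (inner_lin Y)"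
        unfolding f by (rule inner_log_linearizationsE[OF _ psi])
      then show "0 \<le> total_mass f - total_mass q" using finite_mass(2) by simp
    qed
  qed
  have main: "G N f \<le> total_mass f - (1 - e) ^ CARD('n) * total_mass (exp_neg (inner_lin X))"
    if X: "finite X" "X \<noteq> {}" "card X \<le> N" "X \<subseteq> epi \<phi>" and e: "0 < e" "e < 1" for X e
  proof -
    \<comment> \<open>A vertex of height \<open>s\<close> for the rearrangement lies in the ball with the volume of the level of
      \<open>\<psi>\<close> at height \<open>s\<close>; it is replaced by a point of that level, at the same height.\<close>
    have mem: "level \<psi> (snd p) \<noteq> {}" "norm (fst p) \<le> vol_radius (level \<psi> (snd p))" if "p \<in> X" for p
      using that X(4) psi_star_le_iff[OF psi, of "fst p" "snd p"]
      by (auto simp: \<phi>_def epi_def mem_sym_ball_iff)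
    have body: "compact (level \<psi> (snd p)) \<and> convex (level \<psi> (snd p)) \<and> level \<psi> (snd p) \<noteq> {}"
      if "p \<in> X" for p
      using compact_level[OF psi] convex_level[OF psi] mem(1)[OF that] by blast
    have radius: "0 \<le> vol_radius (level \<psi> s) \<and>
        measure lborel (cball (0::real^'n) (vol_radius (level \<psi> s))) = measure lborel (level \<psi> s)" for s
      using vol_radius[of "level \<psi> s"] measure_lebesgue_eq_lborel[OF compact_level[OF psi, of s]]
        measure_lebesgue_eq_lborel[OF compact_cball[of "0::real^'n" "vol_radius (level \<psi> s)"]]
      by simp
    have "\<exists>z. (\<forall>p\<in>X. z p \<in> level \<psi> (snd p)) \<and>
        ennreal ((1 - e) ^ CARD('n)) * hull_mass X fst snd \<le> hull_mass X z snd"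
      by (rule exists_hull_mass_ge_balls[OF X(1) body radius mem(2) e, where y = snd]) (assumption | blast)+
    then obtain z where z: "\<forall>p\<in>X. z p \<in> level \<psi> (snd p)"
      "ennreal ((1 - e) ^ CARD('n)) * hull_mass X fst snd \<le> hull_mass X z snd"
      by blast
    define Y where "Y = (\<lambda>p. (z p, snd p)) ` X"
    have Y: "finite Y" "Y \<noteq> {}" "card Y \<le> N" "Y \<subseteq> epi \<psi>"
      using X z(1) card_image_le[OF X(1), of "\<lambda>p. (z p, snd p)"]
      by (auto simp: Y_def epi_def level_def)
    have "ennreal ((1 - e) ^ CARD('n)) * (\<integral>\<^sup>+x. exp_neg (inner_lin X) x \<partial>lborel)
        \<le> (\<integral>\<^sup>+x. exp_neg (inner_lin Y) x \<partial>lborel)"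
      using z(2) unfolding hull_mass_id by (simp add: hull_mass_def Y_def)
    then have "enn2real (ennreal ((1 - e) ^ CARD('n)) * (\<integral>\<^sup>+x. exp_neg (inner_lin X) x \<partial>lborel))
        \<le> enn2real (\<integral>\<^sup>+x. exp_neg (inner_lin Y) x \<partial>lborel)"
      using finite_mass(1)[OF Y(1,4)] by (intro enn2real_mono) simp_all
    then have "(1 - e) ^ CARD('n) * total_mass (exp_neg (inner_lin X)) \<le> total_mass (exp_neg (inner_lin Y))"
      unfolding total_mass_eq_nn_integral[OF borel_measurable_inner_lin[OF X(1)] exp_neg_nonneg]
        total_mass_eq_nn_integral[OF borel_measurable_inner_lin[OF Y(1)] exp_neg_nonneg]
      using e by (simp add: enn2real_mult)
    then show ?thesis using G_le[OF Y] by linarith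
  qed
  show ?thesis
    unfolding fs G_def[of N "exp_neg \<phi>"]
  proof (rule cINF_greatest)
    have "0 \<in> eff_dom \<phi>" using phi by (simp add: Conv_c_def)
    then obtain a where a: "\<phi> 0 = ereal a" using Conv_c_not_minus_infinity[OF phi, of 0] by (cases "\<phi> 0") (auto simp: eff_dom_def)
    have "exp_neg (inner_lin {(0, a)}) \<in> inner_log_linearizations N (exp_neg \<phi>)"
      by (rule inner_log_linearizationsI[OF phi]) (use a assms(1) in \<open>auto simp: epi_def\<close>)
    then show "inner_log_linearizations N (exp_neg \<phi>) \<noteq> {}" by blast
    fix q assume "q \<in> inner_log_linearizations N (exp_neg \<phi>)"
    then obtain X where X: "finite X" "X \<noteq> {}" "card X \<le> N" "X \<subseteq> epi \<phi>" "q = exp_neg (inner_lin X)"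
      by (rule inner_log_linearizationsE[OF _ phi])
    \<comment> \<open>The loss factor \<open>(1 - e) ^ CARD('n)\<close> tends to one; the double successor keeps \<open>e\<close> below one.\<close>
    have "(\<lambda>k. total_mass f - (1 - 1 / Suc (Suc k)) ^ CARD('n) * total_mass q)
        \<longlonglongrightarrow> total_mass f - (1 - 0) ^ CARD('n) * total_mass q"
      by (intro tendsto_intros LIMSEQ_Suc[OF LIMSEQ_inverse_real_of_nat[unfolded inverse_eq_divide]])
    moreover have "G N f \<le> total_mass f - (1 - 1 / Suc (Suc k)) ^ CARD('n) * total_mass q" for k
      unfolding X(5) by (rule main[OF X(1-4)]) simp_all
    ultimately have "G N f \<le> total_mass f - (1 - 0) ^ CARD('n) * total_mass q"
      by (intro LIMSEQ_le_const) auto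
    then show "G N f \<le> total_mass (exp_neg \<phi>) - total_mass q" by (simp add: mass_eq)
  qed
qed

end
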